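(* The map $U:\mathrm{QSym}\to\mathrm{QSym}$ is a Hopf algebra endomorphism of the Hopf algebra $\mathrm{QSym}$ of quasisymmetric functions.
   Context: Let $\mathbf{k}$ be a field and $\mathbf{k}\langle\mathbf{a},\mathbf{b}\rangle$ the algebra of polynomials in noncommuting variables $\mathbf{a},\mathbf{b}$ of degree $1$. Coproduct: for a monomial $u_1\cdots u_n$, $\Delta(u_1\cdots u_n)=\sum_{i=1}^n u_1\cdots u_{i-1}\otimes u_{i+1}\cdots u_n$ (so $\Delta(1)=0$), extended linearly; it is coassociative. $\Delta^1=\mathrm{id}$, $\Delta^{k+1}=(\mathrm{id}\otimes\Delta^k)\circ\Delta$, with Sweedler notation $\Delta^k(u)=\sum_u u_{(1)}\otimes\cdots\otimes u_{(k)}$. $A$ is the algebra map to scalars with $A(\mathbf{a})=1$, $A(\mathbf{b})=0$; $C(u)=2A(u)+\sum_u A(u_{(1)})A(u_{(2)})$. For homogeneous $u$, $\kappa(u)=A(u)(\mathbf{a}-\mathbf{b})^{\deg u}$ and $\nu(u)=C(u)(\mathbf{a}-\mathbf{b})^{\deg u}$, extended linearly. Let $T(u)=\sum_{k\ge1}\sum_u \nu(u_{(1)})\cdot\mathbf{b}\cdots\mathbf{b}\cdot\nu(u_{(k-1)})\cdot\mathbf{b}\cdot\kappa(u_{(k)})$ (coproduct into $k$ parts). Let $H^*$ be the linear map with $H^*(1)=0$ and $H^*(u\cdot\mathbf{a})=H^*(u\cdot\mathbf{b})=u$. The Tchebyshev transform of the second kind is the linear map $U(u)=H^*(T(u\cdot\mathbf{a}))$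 on $\mathbf{ab}$-polynomials. $\mathrm{QSym}$ is the algebra (over $\mathbf{k}$) of quasisymmetric functions in the variables $t_1,t_2,\ldots$, with linear basis the monomial quasisymmetric functions $M_{(p_1,\ldots,p_k)}=\sum_{i_1<\cdots<i_k}t_{i_1}^{p_1}\cdots t_{i_k}^{p_k}$ (all $p_i\ge1$, $k\geq 0$; the empty one is the unit $1_{\mathrm{QSym}}$); its product is the product of power series, and its coproduct is $\Delta^{\mathrm{QSym}}(M_{(p_1,\ldots,p_k)})=\sum_{i=0}^k M_{(p_1,\ldots,p_i)}\otimes M_{(p_{i+1},\ldots,p_k)}$; the counit is the constant term. The linear map $\gamma:\mathbf{k}\langle\mathbf{a},\mathbf{b}\rangle\to\mathrm{QSym}$ given by $\gamma((\mathbf{a}-\mathbf{b})^{p_1-1}\cdot\mathbf{b}\cdot(\mathbf{a}-\mathbf{b})^{p_2-1}\cdot\mathbf{b}\cdots\mathbf{b}\cdot(\mathbf{a}-\mathbf{b})^{p_k-1})=M_{(p_1,\ldots,p_k)}$ ($k\ge1$) is a linear isomorphism onto the quasisymmetric functions with no constant term. The map $U$ on $\mathrm{QSym}$ is the linear map with $U(1_{\mathrm{QSym}})=1_{\mathrm{QSym}}$ and $U(f)=\gamma(U(\gamma^{-1}(f)))$ for $f$ with no constant term. *)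

theory Defs
  imports Complex_Main "HOL-Library.Poly_Mapping"
begin

section \<open>Linear extension from a basis\<close>

text \<open>The free vector space on a set of basis elements of type \<open>'b\<close> is \<open>'b \<Rightarrow>\<^sub>0 'k\<close>.\<close>

definition pscale :: "'k::semiring_0 \<Rightarrow> ('b \<Rightarrow>\<^sub>0 'k) \<Rightarrow> ('b \<Rightarrow>\<^sub>0 'k)" where
  "pscale c u = Poly_Mapping.map ((*) c) u"

definition lin_ext :: "('k::zero \<Rightarrow> 'v \<Rightarrow> 'v) \<Rightarrow> ('b \<Rightarrow> 'v::comm_monoid_add) \<Rightarrow> ('b \<Rightarrow>\<^sub>0 'k) \<Rightarrow> 'v" where
  "lin_ext scale f u = (\<Sum>x\<in>Poly_Mapping.keys u. scale (Poly_Mapping.lookup u x) (f x))"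

lemma lookup_pscale [simp]: "Poly_Mapping.lookup (pscale c u) x = c * Poly_Mapping.lookup u x"
  unfolding pscale_def by (transfer; auto simp: when_def)

lemma vector_space_pscale: "vector_space (pscale :: 'k::field \<Rightarrow> ('b \<Rightarrow>\<^sub>0 'k) \<Rightarrow> _)"
  by unfold_locales (auto intro!: poly_mapping_eqI simp: lookup_add algebra_simps)

lemma vector_space_mult: "vector_space ((*) :: 'k::field \<Rightarrow> 'k \<Rightarrow> 'k)"
  by unfold_locales (auto simp: algebra_simps)

lemma lin_ext_superset:
  assumes "vector_space s" "finite S" "Poly_Mapping.keys u \<subseteq> S"
  shows "lin_ext s f u = (\<Sum>x\<in>S. s (Poly_Mapping.lookup u x) (f x))"
proof -
  interpret vector_space s by fact
  show ?thesis unfolding lin_ext_def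
    by (rule sum.mono_neutral_left) (use assms in \<open>auto simp: in_keys_iff\<close>)
qed

lemma linear_lin_ext:
  fixes s :: "'k::field \<Rightarrow> 'v::ab_group_add \<Rightarrow> 'v" and f :: "'b \<Rightarrow> 'v"
  assumes "vector_space s"
  shows "Vector_Spaces.linear pscale s (lin_ext s f)"
  unfolding Vector_Spaces.linear_iff
proof (intro conjI allI)
  interpret vector_space s by fact
  fix u v :: "'b \<Rightarrow>\<^sub>0 'k" and c :: 'k
  let ?S = "Poly_Mapping.keys u \<union> Poly_Mapping.keys v"
  have "lin_ext s f (u + v) = (\<Sum>x\<in>?S. s (Poly_Mapping.lookup (u + v) x) (f x))"
    by (rule lin_ext_superset[OF assms]) (auto dest: subsetD[OF keys_add])
  also have "\<dots> = (\<Sum>x\<in>?S. s (Poly_Mapping.lookup u x) (f x)) + (\<Sum>x\<in>?S. s (Poly_Mapping.lookup v x) (f x))"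
    by (simp add: lookup_add scale_left_distrib sum.distrib)
  also have "\<dots> = lin_ext s f u + lin_ext s f v"
    by (subst (1 2) lin_ext_superset[OF assms, of ?S]) auto
  finally show "lin_ext s f (u + v) = lin_ext s f u + lin_ext s f v" .
  have "lin_ext s f (pscale c u) = (\<Sum>x\<in>Poly_Mapping.keys u. s (Poly_Mapping.lookup (pscale c u) x) (f x))"
    by (rule lin_ext_superset[OF assms]) (auto simp: in_keys_iff)
  also have "\<dots> = s c (lin_ext s f u)"
    by (simp add: lin_ext_def scale_sum_right)
  finally show "lin_ext s f (pscale c u) = s c (lin_ext s f u)" .
qed (use assms vector_space_pscale in auto)

lemma lin_ext_single:
  assumes "vector_space s"
  shows "lin_ext s f (Poly_Mapping.single x c) = s c (f x)"
proof -
  interpret vector_space s by fact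
  show ?thesis by (subst lin_ext_superset[OF assms, of "{x}"]) auto
qed

lemma poly_mapping_expand:
  fixes u :: "'b \<Rightarrow>\<^sub>0 'k::field"
  shows "u = (\<Sum>x\<in>Poly_Mapping.keys u. pscale (Poly_Mapping.lookup u x) (Poly_Mapping.single x 1))"
proof (rule poly_mapping_eqI)
  fix k
  have "(\<Sum>x\<in>Poly_Mapping.keys u. Poly_Mapping.lookup u x * Poly_Mapping.lookup (Poly_Mapping.single x 1) k)
      = (\<Sum>x\<in>Poly_Mapping.keys u. if x = k then Poly_Mapping.lookup u x else 0)"
    by (rule sum.cong) (auto simp: lookup_single when_def)
  also have "\<dots> = Poly_Mapping.lookup u k" by (simp add: in_keys_iff)
  finally show "Poly_Mapping.lookup u k = Poly_Mapping.lookup (\<Sum>x\<in>Poly_Mapping.keys u.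
      pscale (Poly_Mapping.lookup u x) (Poly_Mapping.single x 1)) k"
    by (simp add: lookup_sum)
qed

lemma linear_eqI:
  assumes "Vector_Spaces.linear pscale s g" "Vector_Spaces.linear pscale s h"
    and "\<And>x. g (Poly_Mapping.single x 1) = h (Poly_Mapping.single x 1)"
  shows "g = h"
proof
  fix u
  interpret g: Vector_Spaces.linear pscale s g by fact
  interpret h: Vector_Spaces.linear pscale s h by fact
  show "g u = h u"
    by (subst (1 2) poly_mapping_expand[of u]) (simp add: g.sum h.sum g.scale h.scale assms)
qed


section \<open>The algebra of ab-polynomials and its coproduct\<close>

datatype letter = La | Lb

text \<open>Words form a monoid under concatenation, so that the convolution product on
  \<open>letter list \<Rightarrow>\<^sub>0 'k\<close> is the product of the free algebra. In the same way
  the product on \<open>letter list list \<Rightarrow>\<^sub>0 'k\<close> is the product of the tensor algebra: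
  the list \<open>[u\<^sub>1, \<dots>, u\<^sub>k]\<close> stands for \<open>u\<^sub>1 \<otimes> \<dots> \<otimes> u\<^sub>k\<close>.\<close>

instantiation list :: (type) monoid_add
begin
definition zero_list :: "'a list" where "zero_list = []"
definition plus_list :: "'a list \<Rightarrow> 'a list \<Rightarrow> 'a list" where "plus_list = (@)"
instance by standard (auto simp: zero_list_def plus_list_def)
end

type_synonym 'k abpoly = "letter list \<Rightarrow>\<^sub>0 'k"

definition avar :: "'k::field abpoly" where "avar = Poly_Mapping.single [La] 1"
definition bvar :: "'k::field abpoly" where "bvar = Poly_Mapping.single [Lb] 1"

definition ab_coprod :: "'k::field abpoly \<Rightarrow> (letter list \<times> letter list \<Rightarrow>\<^sub>0 'k)" where
  "ab_coprod = lin_ext pscale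
     (\<lambda>w. \<Sum>i<length w. Poly_Mapping.single (take i w, drop (Suc i) w) 1)"

text \<open>\<open>ab_coprod_iter k\<close> is the coproduct into \<open>k + 1\<close> parts, i.e. $\Delta^{k+1}$.\<close>

fun ab_coprod_iter :: "nat \<Rightarrow> 'k::field abpoly \<Rightarrow> (letter list list \<Rightarrow>\<^sub>0 'k)" where
  "ab_coprod_iter 0 u = lin_ext pscale (\<lambda>w. Poly_Mapping.single [w] 1) u"
| "ab_coprod_iter (Suc k) u = lin_ext pscale
     (\<lambda>(v, w). Poly_Mapping.single [v] 1 * ab_coprod_iter k (Poly_Mapping.single w 1))
     (ab_coprod u)"


section \<open>The Tchebyshev transform of the second kind\<close>

definition A_map :: "'k::field abpoly \<Rightarrow> 'k" where
  "A_map = lin_ext (*) (\<lambda>w. \<Prod>x\<leftarrow>w. case x of La \<Rightarrow> 1 | Lb \<Rightarrow> 0)"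

definition C_map :: "'k::field abpoly \<Rightarrow> 'k" where
  "C_map u = 2 * A_map u +
     lin_ext (*) (\<lambda>(v, w). A_map (Poly_Mapping.single v 1) * A_map (Poly_Mapping.single w 1))
       (ab_coprod u)"

definition kappa :: "'k::field abpoly \<Rightarrow> 'k abpoly" where
  "kappa = lin_ext pscale
     (\<lambda>w. pscale (A_map (Poly_Mapping.single w 1)) ((avar - bvar) ^ length w))"

definition nu :: "'k::field abpoly \<Rightarrow> 'k abpoly" where
  "nu = lin_ext pscale
     (\<lambda>w. pscale (C_map (Poly_Mapping.single w 1)) ((avar - bvar) ^ length w))"

fun T_term :: "letter list list \<Rightarrow> 'k::field abpoly" where
  "T_term [] = 0"
| "T_term [w] = kappa (Poly_Mapping.single w 1)"
| "T_term (w # w' # ws) = nu (Poly_Mapping.single w 1) * bvar * T_term (w' # ws)"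

text \<open>The sum over \<open>k\<close> has finite support by \<open>finite_T_terms\<close> below; the summand with index
  \<open>k\<close> is the one for the coproduct into \<open>k + 1\<close> parts.\<close>

definition T_map :: "'k::field abpoly \<Rightarrow> 'k abpoly" where
  "T_map u = Sum_any (\<lambda>k. lin_ext pscale T_term (ab_coprod_iter k u))"

definition H_star :: "'k::field abpoly \<Rightarrow> 'k abpoly" where
  "H_star = lin_ext pscale (\<lambda>w. if w = [] then 0 else Poly_Mapping.single (butlast w) 1)"

definition U_ab :: "'k::field abpoly \<Rightarrow> 'k abpoly" where
  "U_ab u = H_star (T_map (u * avar))"

lemma linear_ab_coprod_iter:
  "Vector_Spaces.linear pscale pscale (ab_coprod_iter k :: 'k::field abpoly \<Rightarrow> _)"
proof (cases k)
  case 0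
  have "ab_coprod_iter 0 = (lin_ext pscale (\<lambda>w. Poly_Mapping.single [w] 1) :: 'k::field abpoly \<Rightarrow> _)"
    by (rule ext) simp
  then show ?thesis using linear_lin_ext[OF vector_space_pscale] 0 by metis
next
  case (Suc k)
  interpret D: Vector_Spaces.linear pscale pscale "ab_coprod :: 'k abpoly \<Rightarrow> _"
    unfolding ab_coprod_def by (rule linear_lin_ext[OF vector_space_pscale])
  interpret L: Vector_Spaces.linear pscale pscale "lin_ext pscale
     (\<lambda>(v, w). Poly_Mapping.single [v] 1 * ab_coprod_iter k (Poly_Mapping.single w (1::'k)))"
    by (rule linear_lin_ext[OF vector_space_pscale])
  show ?thesis unfolding Vector_Spaces.linear_iff Suc
    by (auto simp: D.add D.scale L.add L.scale vector_space_pscale)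
qed

lemma ab_coprod_iter_eq_0:
  "length w < k \<Longrightarrow> ab_coprod_iter k (Poly_Mapping.single w (1::'k::field)) = 0"
proof (induction k arbitrary: w)
  case (Suc k)
  interpret L: Vector_Spaces.linear pscale pscale "lin_ext pscale
     (\<lambda>(v, w). Poly_Mapping.single [v] 1 * ab_coprod_iter k (Poly_Mapping.single w (1::'k)))"
    by (rule linear_lin_ext[OF vector_space_pscale])
  interpret P: vector_space "pscale :: 'k \<Rightarrow> (letter list list \<Rightarrow>\<^sub>0 'k) \<Rightarrow> _" by (rule vector_space_pscale)
  interpret P2: vector_space "pscale :: 'k \<Rightarrow> (letter list \<times> letter list \<Rightarrow>\<^sub>0 'k) \<Rightarrow> _" by (rule vector_space_pscale)
  have "ab_coprod (Poly_Mapping.single w (1::'k)) = (\<Sum>i<length w. Poly_Mapping.single (take i w, drop (Suc i) w) 1)"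
    by (simp add: ab_coprod_def lin_ext_single[OF vector_space_pscale])
  then have "ab_coprod_iter (Suc k) (Poly_Mapping.single w (1::'k)) =
     (\<Sum>i<length w. Poly_Mapping.single [take i w] 1 * ab_coprod_iter k (Poly_Mapping.single (drop (Suc i) w) (1::'k)))"
    by (simp add: L.sum lin_ext_single[OF vector_space_pscale])
  also have "\<dots> = 0"
    by (rule sum.neutral) (use Suc in auto)
  finally show ?case .
qed auto

lemma finite_T_terms:
  "finite {k. lin_ext pscale T_term (ab_coprod_iter k (u :: 'k::field abpoly)) \<noteq> 0}"
proof -
  let ?n = "Max (insert 0 (length ` Poly_Mapping.keys u))"
  interpret P: vector_space "pscale :: 'k \<Rightarrow> (letter list list \<Rightarrow>\<^sub>0 'k) \<Rightarrow> _" by (rule vector_space_pscale)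
  have "ab_coprod_iter k u = 0" if "k > ?n" for k
  proof -
    interpret L: Vector_Spaces.linear pscale pscale "ab_coprod_iter k :: 'k abpoly \<Rightarrow> _"
      by (rule linear_ab_coprod_iter)
    have "length x < k" if "x \<in> Poly_Mapping.keys u" for x
      using that \<open>k > ?n\<close> by (intro le_less_trans[OF _ \<open>k > ?n\<close>] Max_ge) auto
    then show ?thesis
      by (subst poly_mapping_expand[of u]) (auto simp: L.sum L.scale ab_coprod_iter_eq_0 intro!: sum.neutral)
  qed
  then have "{k. lin_ext pscale T_term (ab_coprod_iter k u) \<noteq> 0} \<subseteq> {..?n}"
    by (force simp: lin_ext_def not_less[symmetric] simp del: Max_insert Max_less_iff)
  then show ?thesis using finite_subset by blast
qed


section \<open>Formal power series in countably many variables\<close>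

text \<open>A monomial is an exponent vector \<open>nat \<Rightarrow>\<^sub>0 nat\<close>; the variable with index \<open>i\<close> plays the
  role of $t_{i+1}$.\<close>

typedef 'k mps = "UNIV :: ((nat \<Rightarrow>\<^sub>0 nat) \<Rightarrow> 'k) set"
  morphisms coeff Mps by auto

lemma coeff_Mps [simp]: "coeff (Mps f) = f"
  by (simp add: Mps_inverse)

lemma mps_eqI: "(\<And>m. coeff f m = coeff g m) \<Longrightarrow> f = g"
  using coeff_inject ext by blast

lemma finite_splits: "finite {(m1, m2). m1 + m2 = (m :: nat \<Rightarrow>\<^sub>0 nat)}"
proof -
  let ?N = "Max (insert 0 (Poly_Mapping.lookup m ` Poly_Mapping.keys m))"
  let ?F = "{f. \<forall>x. (x \<in> Poly_Mapping.keys m \<longrightarrow> f x \<in> {..?N}) \<and> (x \<notin> Poly_Mapping.keys m \<longrightarrow> f x = 0)}"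
  have F: "finite ?F" by (rule finite_set_of_finite_funs) auto
  have bound: "Poly_Mapping.lookup m' \<in> ?F" if "\<And>x. Poly_Mapping.lookup m' x \<le> Poly_Mapping.lookup m x" for m'
  proof (intro CollectI allI conjI impI)
    fix x
    { assume "x \<in> Poly_Mapping.keys m"
      then have "Poly_Mapping.lookup m x \<le> ?N" by (intro Max_ge) auto
      then show "Poly_Mapping.lookup m' x \<in> {..?N}" using that[of x] by simp }
    { assume "x \<notin> Poly_Mapping.keys m"
      then show "Poly_Mapping.lookup m' x = 0" using that[of x] by (simp add: in_keys_iff) }
  qed
  let ?G = "(\<lambda>(m1, m2). (Poly_Mapping.lookup m1, Poly_Mapping.lookup m2)) ` {(m1, m2). m1 + m2 = m}"
  have "?G \<subseteq> ?F \<times> ?F"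
  proof
    fix z assume "z \<in> ?G"
    then obtain m1 m2 where z: "z = (Poly_Mapping.lookup m1, Poly_Mapping.lookup m2)" and "m1 + m2 = m"
      by auto
    then have "Poly_Mapping.lookup m1 x \<le> Poly_Mapping.lookup m x"
      "Poly_Mapping.lookup m2 x \<le> Poly_Mapping.lookup m x" for x
      by (auto simp: lookup_add)
    then show "z \<in> ?F \<times> ?F" unfolding z by (intro SigmaI bound) auto
  qed
  then have "finite ?G" using F finite_subset by blast
  then show ?thesis
    by (rule finite_imageD) (auto simp: inj_on_def lookup_inject)
qed

instantiation mps :: (comm_ring_1) comm_ring_1
begin

definition zero_mps :: "'a mps" where "0 = Mps (\<lambda>m. 0)"
definition one_mps :: "'a mps" where "1 = Mps (\<lambda>m. if m = 0 then 1 else 0)"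
definition plus_mps :: "'a mps \<Rightarrow> 'a mps \<Rightarrow> 'a mps" where
  "f + g = Mps (\<lambda>m. coeff f m + coeff g m)"
definition minus_mps :: "'a mps \<Rightarrow> 'a mps \<Rightarrow> 'a mps" where
  "f - g = Mps (\<lambda>m. coeff f m - coeff g m)"
definition uminus_mps :: "'a mps \<Rightarrow> 'a mps" where
  "- f = Mps (\<lambda>m. - coeff f m)"
definition times_mps :: "'a mps \<Rightarrow> 'a mps \<Rightarrow> 'a mps" where
  "f * g = Mps (\<lambda>m. \<Sum>(m1, m2)\<in>{(m1, m2). m1 + m2 = m}. coeff f m1 * coeff g m2)"

instance
proof
  fix f g h :: "'a mps"
  show "f * g * h = f * (g * h)"
  proof (rule mps_eqI)
    fix m
    let ?D = "\<lambda>m. {(m1, m2). m1 + m2 = (m :: nat \<Rightarrow>\<^sub>0 nat)}"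
    have "coeff (f * g * h) m = (\<Sum>x\<in>?D m. \<Sum>y\<in>?D (fst x). coeff f (fst y) * coeff g (snd y) * coeff h (snd x))"
      by (simp add: times_mps_def case_prod_beta sum_distrib_right)
    also have "\<dots> = (\<Sum>(x, y)\<in>(SIGMA x:?D m. ?D (fst x)). coeff f (fst y) * coeff g (snd y) * coeff h (snd x))"
      by (rule sum.Sigma) (auto simp: finite_splits)
    also have "\<dots> = (\<Sum>(x, y)\<in>(SIGMA x:?D m. ?D (snd x)). coeff f (fst x) * (coeff g (fst y) * coeff h (snd y)))"
      by (rule sum.reindex_bij_witness[where
            i = "\<lambda>(x, y). ((fst x + fst y, snd y), (fst x, fst y))" and
            j = "\<lambda>(x, y). ((fst y, snd y + snd x), (snd y, snd x))"])
         (auto simp: add.assoc mult.assoc)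
    also have "\<dots> = (\<Sum>x\<in>?D m. \<Sum>y\<in>?D (snd x). coeff f (fst x) * (coeff g (fst y) * coeff h (snd y)))"
      by (rule sum.Sigma[symmetric]) (auto simp: finite_splits)
    also have "\<dots> = coeff (f * (g * h)) m"
      by (simp add: times_mps_def case_prod_beta sum_distrib_left)
    finally show "coeff (f * g * h) m = coeff (f * (g * h)) m" .
  qed
  show "f * g = g * f"
  proof (rule mps_eqI)
    fix m
    show "coeff (f * g) m = coeff (g * f) m"
      unfolding times_mps_def coeff_Mps
      by (rule sum.reindex_bij_witness[where i = prod.swap and j = prod.swap])
         (auto simp: add.commute mult.commute)
  qed
  show "1 * f = f"
  proof (rule mps_eqI)
    fix m :: "nat \<Rightarrow>\<^sub>0 nat"
    have "coeff (1 * f) m = (\<Sum>(m1, m2)\<in>{(m1, m2). m1 + m2 = m}. if m1 = 0 then coeff f m2 else 0)"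
      by (auto simp: times_mps_def one_mps_def intro!: sum.cong)
    also have "\<dots> = (\<Sum>(m1, m2)\<in>{(0 :: nat \<Rightarrow>\<^sub>0 nat, m)}. if m1 = 0 then coeff f m2 else 0)"
      by (rule sum.mono_neutral_right[OF finite_splits]) (auto split: if_splits)
    finally show "coeff (1 * f) m = coeff f m" by simp
  qed
  show "(f + g) * h = f * h + g * h"
    by (rule mps_eqI) (simp add: times_mps_def plus_mps_def case_prod_beta sum.distrib algebra_simps)
  show "(0::'a mps) \<noteq> 1"
  proof
    assume "(0::'a mps) = 1"
    then have "coeff (0::'a mps) 0 = coeff 1 0" by simp
    then show False by (simp add: zero_mps_def one_mps_def)
  qed
qed (auto intro!: mps_eqI simp: plus_mps_def zero_mps_def minus_mps_def uminus_mps_def algebra_simps)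

end

definition mscale :: "'k::times \<Rightarrow> 'k mps \<Rightarrow> 'k mps" where
  "mscale c f = Mps (\<lambda>m. c * coeff f m)"

lemma coeff_simps [simp]:
  "coeff (0 :: 'k::comm_ring_1 mps) m = 0"
  "coeff (f + g :: 'k::comm_ring_1 mps) m = coeff f m + coeff g m"
  "coeff (f - g :: 'k::comm_ring_1 mps) m = coeff f m - coeff g m"
  "coeff (- f :: 'k::comm_ring_1 mps) m = - coeff f m"
  "coeff (1 :: 'k::comm_ring_1 mps) m = (if m = 0 then 1 else 0)"
  "coeff (mscale c f) m = c * coeff f m"
  by (simp_all add: zero_mps_def one_mps_def plus_mps_def minus_mps_def uminus_mps_def mscale_def)

lemma coeff_sum [simp]: "coeff (sum f A :: 'k::comm_ring_1 mps) m = (\<Sum>x\<in>A. coeff (f x) m)"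
  by (induction A rule: infinite_finite_induct) auto

lemma vector_space_mscale: "vector_space (mscale :: 'k::field \<Rightarrow> _)"
  by unfold_locales (auto intro!: mps_eqI simp: algebra_simps)


section \<open>Quasisymmetric functions\<close>

definition compositions :: "nat list set" where
  "compositions = {p. \<forall>x\<in>set p. 1 \<le> x}"

text \<open>\<open>monom is p\<close> is $t_{i_1}^{p_1} \cdots t_{i_k}^{p_k}$.\<close>

definition monom :: "nat list \<Rightarrow> nat list \<Rightarrow> (nat \<Rightarrow>\<^sub>0 nat)" where
  "monom is p = (\<Sum>j<length p. Poly_Mapping.single (is ! j) (p ! j))"

definition QSym :: "'k::field mps set" where
  "QSym = {f. (\<exists>d. \<forall>m. coeff f m \<noteq> 0 \<longrightarrow> (\<Sum>i\<in>Poly_Mapping.keys m. Poly_Mapping.lookup m i) \<le> d) \<and>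
     (\<forall>p\<in>compositions. \<forall>is js. sorted_wrt (<) is \<and> sorted_wrt (<) js \<and>
        length is = length p \<and> length js = length p \<longrightarrow> coeff f (monom is p) = coeff f (monom js p))}"

text \<open>For a composition \<open>p\<close>, distinct increasing sequences of indices give distinct monomials.\<close>

definition M :: "nat list \<Rightarrow> 'k::field mps" where
  "M p = Mps (\<lambda>m. if \<exists>is. sorted_wrt (<) is \<and> length is = length p \<and> m = monom is p then 1 else 0)"


global_interpretation mps: vector_space "mscale :: 'k::field \<Rightarrow> _"
  by (rule vector_space_mscale)

lemma lookup_monom:
  assumes "sorted_wrt (<) is" "length is = length p" "j < length p"
  shows "Poly_Mapping.lookup (monom is p) (is ! j) = p ! j"
proof -
  have "distinct is" using assms(1) by (simp add: strict_sorted_iff)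
  then have "Poly_Mapping.lookup (monom is p) (is ! j) = (\<Sum>j'<length p. if j' = j then p ! j' else 0)"
    unfolding monom_def lookup_sum
    by (intro sum.cong) (use assms in \<open>auto simp: lookup_single when_def nth_eq_iff_index_eq\<close>)
  then show ?thesis using assms by simp
qed

lemma lookup_monom_notin:
  "length is = length p \<Longrightarrow> x \<notin> set is \<Longrightarrow> Poly_Mapping.lookup (monom is p) x = 0"
  unfolding monom_def lookup_sum by (intro sum.neutral) (auto simp: lookup_single when_def)

lemma keys_monom:
  assumes "sorted_wrt (<) is" "length is = length p" "p \<in> compositions"
  shows "Poly_Mapping.keys (monom is p) = set is"
proof (intro set_eqI iffI)
  fix x assume "x \<in> set is"
  then obtain j where "j < length p" "x = is ! j" using assms by (auto simp: in_set_conv_nth)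
  moreover have "p ! j \<noteq> 0" using assms(3) nth_mem[OF \<open>j < length p\<close>] unfolding compositions_def
    by (metis (mono_tags, lifting) mem_Collect_eq not_one_le_zero)
  ultimately show "x \<in> Poly_Mapping.keys (monom is p)" using lookup_monom[OF assms(1,2)]
    by (simp add: in_keys_iff)
next
  fix x assume "x \<in> Poly_Mapping.keys (monom is p)"
  then show "x \<in> set is" using lookup_monom_notin[OF assms(2)] by (metis in_keys_iff)
qed

lemma monom_unique:
  assumes "sorted_wrt (<) is" "length is = length p" "p \<in> compositions"
    and "sorted_wrt (<) js" "length js = length q" "q \<in> compositions"
    and "monom is p = monom js q"
  shows "is = js \<and> p = q"
proof -
  have "set is = set js" using keys_monom assms by metis
  then have eq: "is = js" using assms(1,4) strict_sorted_equal by blast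
  have "p = q"
  proof (rule nth_equalityI)
    show "length p = length q" using assms eq by simp
    fix j assume j: "j < length p"
    then have "Poly_Mapping.lookup (monom is p) (is ! j) = p ! j"
      using lookup_monom[OF assms(1,2)] by simp
    moreover have "Poly_Mapping.lookup (monom js q) (js ! j) = q ! j"
      using lookup_monom[OF assms(4,5)] j assms eq by simp
    ultimately show "p ! j = q ! j" using eq assms(7) by simp
  qed
  with eq show ?thesis by simp
qed

lemma monom_exists:
  obtains "is" p where "sorted_wrt (<) is" "length is = length p" "p \<in> compositions" "m = monom is p"
proof -
  let ?is = "sorted_list_of_set (Poly_Mapping.keys m)"
  let ?p = "map (Poly_Mapping.lookup m) ?is"
  have 1: "sorted_wrt (<) ?is" "length ?is = length ?p" by auto
  have 2: "?p \<in> compositions" by (auto simp: compositions_def in_keys_iff)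
  have 3: "m = monom ?is ?p"
  proof (rule poly_mapping_eqI)
    fix x
    show "Poly_Mapping.lookup m x = Poly_Mapping.lookup (monom ?is ?p) x"
    proof (cases "x \<in> set ?is")
      case True
      then obtain j where j: "j < length ?p" "x = ?is ! j" by (metis in_set_conv_nth 1(2))
      then show ?thesis using lookup_monom[OF 1 j(1)] by simp
    next
      case False
      then show ?thesis using lookup_monom_notin[OF 1(2) False] by (simp add: in_keys_iff)
    qed
  qed
  show ?thesis by (rule that[OF 1 2 3])
qed

lemma coeff_M:
  assumes "p \<in> compositions" "q \<in> compositions" "sorted_wrt (<) is" "length is = length q"
  shows "coeff (M p) (monom is q) = (if p = q then 1 else 0)"
  using assms monom_unique[of "is" q _ p] by (auto simp: M_def)

lemma degree_monom:
  assumes "sorted_wrt (<) is" "length is = length p" "p \<in> compositions"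
  shows "(\<Sum>i\<in>Poly_Mapping.keys (monom is p). Poly_Mapping.lookup (monom is p) i) = sum_list p"
proof -
  have "distinct is" using assms(1) by (simp add: strict_sorted_iff)
  then have "(\<Sum>i\<in>set is. Poly_Mapping.lookup (monom is p) i) = sum_list (map (Poly_Mapping.lookup (monom is p)) is)"
    by (simp add: sum_list_distinct_conv_sum_set)
  also have "map (Poly_Mapping.lookup (monom is p)) is = p"
    by (rule nth_equalityI) (use assms lookup_monom[OF assms(1,2)] in auto)
  finally show ?thesis using keys_monom[OF assms] by simp
qed

lemma subspace_QSym: "mps.subspace QSym"
  unfolding mps.subspace_def
proof (intro conjI ballI allI)
  fix f g :: "'a mps" assume fg: "f \<in> QSym" "g \<in> QSym"
  from fg obtain d e where
    d: "coeff f m \<noteq> 0 \<longrightarrow> (\<Sum>i\<in>Poly_Mapping.keys m. Poly_Mapping.lookup m i) \<le> d" and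
    e: "coeff g m \<noteq> 0 \<longrightarrow> (\<Sum>i\<in>Poly_Mapping.keys m. Poly_Mapping.lookup m i) \<le> e" for m
    unfolding QSym_def by blast
  have "coeff (f + g) m \<noteq> 0 \<longrightarrow> (\<Sum>i\<in>Poly_Mapping.keys m. Poly_Mapping.lookup m i) \<le> max d e" for m
    using d[of m] e[of m] by auto
  moreover have "coeff (f + g) (monom is p) = coeff (f + g) (monom js p)"
    if "p \<in> compositions" "sorted_wrt (<) is" "sorted_wrt (<) js" "length is = length p" "length js = length p"
    for "is" js p
  proof -
    have "coeff f (monom is p) = coeff f (monom js p)" "coeff g (monom is p) = coeff g (monom js p)"
      using fg that unfolding QSym_def by blast+
    then show ?thesis by simp
  qed
  ultimately show "f + g \<in> QSym" unfolding QSym_def by blast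
next
  fix f :: "'a mps" and c assume f: "f \<in> QSym"
  then obtain d where
    d: "coeff f m \<noteq> 0 \<longrightarrow> (\<Sum>i\<in>Poly_Mapping.keys m. Poly_Mapping.lookup m i) \<le> d" for m
    unfolding QSym_def by blast
  have "coeff (mscale c f) m \<noteq> 0 \<longrightarrow> (\<Sum>i\<in>Poly_Mapping.keys m. Poly_Mapping.lookup m i) \<le> d" for m
    using d[of m] by auto
  moreover have "coeff (mscale c f) (monom is p) = coeff (mscale c f) (monom js p)"
    if "p \<in> compositions" "sorted_wrt (<) is" "sorted_wrt (<) js" "length is = length p" "length js = length p"
    for "is" js p
  proof -
    have "coeff f (monom is p) = coeff f (monom js p)"
      using f that unfolding QSym_def by blast
    then show ?thesis by simp
  qed
  ultimately show "mscale c f \<in> QSym" unfolding QSym_def by blast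
qed (simp add: QSym_def)

lemma M_in_QSym:
  assumes p: "p \<in> compositions"
  shows "M p \<in> QSym"
  unfolding QSym_def
proof (intro CollectI conjI ballI allI impI)
  show "\<exists>d. \<forall>m. coeff (M p) m \<noteq> 0 \<longrightarrow> (\<Sum>i\<in>Poly_Mapping.keys m. Poly_Mapping.lookup m i) \<le> d"
    by (rule exI[of _ "sum_list p"]) (auto simp: M_def degree_monom p)
qed (auto simp: coeff_M p)

text \<open>\<open>M_coords f\<close> is the coordinate vector of \<open>f\<close> with respect to the basis \<open>M\<close>; it exists and is
  unique by \<open>M_coords_ex1\<close>.\<close>

definition M_coords :: "'k::field mps \<Rightarrow> (nat list \<Rightarrow>\<^sub>0 'k)" where
  "M_coords f = (THE c. Poly_Mapping.keys c \<subseteq> compositions \<and> lin_ext mscale M c = f)"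

lemma coeff_lin_ext_M:
  assumes "Poly_Mapping.keys c \<subseteq> compositions" "q \<in> compositions"
    and "sorted_wrt (<) is" "length is = length q"
  shows "coeff (lin_ext mscale M c) (monom is q) = (Poly_Mapping.lookup c q :: 'k::field)"
proof -
  have "coeff (lin_ext mscale M c) (monom is q) = (\<Sum>p\<in>Poly_Mapping.keys c. if p = q then Poly_Mapping.lookup c p else 0)"
    unfolding lin_ext_def coeff_sum by (rule sum.cong) (use assms in \<open>auto simp: coeff_M subset_iff\<close>)
  then show ?thesis by (simp add: in_keys_iff)
qed

lemma M_coords_ex1:
  assumes f: "(f :: 'k::field mps) \<in> QSym"
  shows "\<exists>!c. Poly_Mapping.keys c \<subseteq> compositions \<and> lin_ext mscale M c = f"
proof (rule ex_ex1I)
  from f obtain d where d: "coeff f m \<noteq> 0 \<longrightarrow> (\<Sum>i\<in>Poly_Mapping.keys m. Poly_Mapping.lookup m i) \<le> d" for m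
    unfolding QSym_def by blast
  let ?c = "\<lambda>p. if p \<in> compositions then coeff f (monom [0..<length p] p) else 0"
  have "{p. ?c p \<noteq> 0} \<subseteq> {p. set p \<subseteq> {..d} \<and> length p \<le> d}"
  proof clarify
    fix p assume "?c p \<noteq> 0"
    then have p: "p \<in> compositions" and "coeff f (monom [0..<length p] p) \<noteq> 0" by (auto split: if_splits)
    with d[of "monom [0..<length p] p"] have le: "sum_list p \<le> d"
      using degree_monom[of "[0..<length p]" p] by simp
    have "length p \<le> sum_list p" using p unfolding compositions_def by (induction p) auto
    moreover have "x \<le> d" if "x \<in> set p" for x using member_le_sum_list[OF that] le by simp
    ultimately show "set p \<subseteq> {..d} \<and> length p \<le> d" using le by auto
  qed
  then have fin: "finite {p. ?c p \<noteq> 0}" using finite_lists_length_le[of "{..d}" d] finite_subset by blast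
  let ?C = "Abs_poly_mapping ?c"
  have l: "Poly_Mapping.lookup ?C = ?c" using fin by (rule lookup_Abs_poly_mapping)
  have k: "Poly_Mapping.keys ?C \<subseteq> compositions" by (auto simp: in_keys_iff l split: if_splits)
  have "lin_ext mscale M ?C = f"
  proof (rule mps_eqI)
    fix m
    obtain "is" p where m: "sorted_wrt (<) is" "length is = length p" "p \<in> compositions" "m = monom is p"
      using monom_exists .
    have "coeff f (monom [0..<length p] p) = coeff f (monom is p)"
      using f m(1-3) sorted_wrt_upt[of 0 "length p"] length_upt[of 0 "length p"]
      unfolding QSym_def mem_Collect_eq by (metis minus_nat.diff_0)
    then show "coeff (lin_ext mscale M ?C) m = coeff f m"
      using coeff_lin_ext_M[OF k m(3,1,2)] m(3) unfolding m(4) by (simp only: l if_True)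
  qed
  with k show "\<exists>c. Poly_Mapping.keys c \<subseteq> compositions \<and> lin_ext mscale M c = f" by blast
next
  fix c c' :: "nat list \<Rightarrow>\<^sub>0 'k"
  assume c: "Poly_Mapping.keys c \<subseteq> compositions \<and> lin_ext mscale M c = f"
    and c': "Poly_Mapping.keys c' \<subseteq> compositions \<and> lin_ext mscale M c' = f"
  show "c = c'"
  proof (rule poly_mapping_eqI)
    fix q
    show "Poly_Mapping.lookup c q = Poly_Mapping.lookup c' q"
    proof (cases "q \<in> compositions")
      case True
      then show ?thesis
        using coeff_lin_ext_M[of c q "[0..<length q]"] coeff_lin_ext_M[of c' q "[0..<length q]"] c c' by simp
    next
      case False
      then have "q \<notin> Poly_Mapping.keys c" "q \<notin> Poly_Mapping.keys c'" using c c' by blast+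
      then show ?thesis by (simp add: in_keys_iff)
    qed
  qed
qed

lemma
  assumes "f \<in> QSym"
  shows keys_M_coords: "Poly_Mapping.keys (M_coords f) \<subseteq> compositions"
    and lin_ext_M_coords: "lin_ext mscale M (M_coords f) = f"
  using theI'[OF M_coords_ex1[OF assms]] by (auto simp: M_coords_def)


section \<open>The bialgebra structure of QSym\<close>

text \<open>\<open>QSym \<otimes> QSym\<close> is the free vector space on the basis elements
  \<open>M p \<otimes> M q\<close>, represented by pairs of compositions.\<close>

type_synonym 'k qsym2 = "nat list \<times> nat list \<Rightarrow>\<^sub>0 'k"

definition qtensor :: "'k::field mps \<Rightarrow> 'k mps \<Rightarrow> 'k qsym2" where
  "qtensor f g = lin_ext pscale
     (\<lambda>p. lin_ext pscale (\<lambda>q. Poly_Mapping.single (p, q) 1) (M_coords g)) (M_coords f)"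

definition qtensor_map :: "('k::field mps \<Rightarrow> 'k mps) \<Rightarrow> ('k mps \<Rightarrow> 'k mps) \<Rightarrow> 'k qsym2 \<Rightarrow> 'k qsym2" where
  "qtensor_map F G = lin_ext pscale (\<lambda>(p, q). qtensor (F (M p)) (G (M q)))"

definition qmult :: "'k::field qsym2 \<Rightarrow> 'k mps" where
  "qmult = lin_ext mscale (\<lambda>(p, q). M p * M q)"

definition qcoprod :: "'k::field mps \<Rightarrow> 'k qsym2" where
  "qcoprod f = lin_ext pscale
     (\<lambda>p. \<Sum>i\<le>length p. Poly_Mapping.single (take i p, drop i p) 1) (M_coords f)"

definition qcounit :: "'k::field mps \<Rightarrow> 'k" where
  "qcounit f = coeff f 0"

definition qsym_linear :: "('k::field mps \<Rightarrow> 'k mps) \<Rightarrow> bool" where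
  "qsym_linear F \<longleftrightarrow> (\<forall>f\<in>QSym. F f \<in> QSym) \<and>
     (\<forall>f\<in>QSym. \<forall>g\<in>QSym. F (f + g) = F f + F g) \<and>
     (\<forall>c. \<forall>f\<in>QSym. F (mscale c f) = mscale c (F f))"

definition qsym_antipode :: "('k::field mps \<Rightarrow> 'k mps) \<Rightarrow> bool" where
  "qsym_antipode S \<longleftrightarrow> qsym_linear S \<and>
     (\<forall>f\<in>QSym. qmult (qtensor_map S id (qcoprod f)) = mscale (qcounit f) 1 \<and>
                qmult (qtensor_map id S (qcoprod f)) = mscale (qcounit f) 1)"

text \<open>Only the values of \<open>F\<close> on \<open>QSym\<close> matter. The antipode of a Hopf algebra is unique; being
  compatible with it is stated here as compatibility with every map satisfying the antipode axioms.\<close>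

definition qsym_hopf_endomorphism :: "('k::field mps \<Rightarrow> 'k mps) \<Rightarrow> bool" where
  "qsym_hopf_endomorphism F \<longleftrightarrow> qsym_linear F \<and>
     F 1 = 1 \<and>
     (\<forall>f\<in>QSym. \<forall>g\<in>QSym. F (f * g) = F f * F g) \<and>
     (\<forall>f\<in>QSym. qcoprod (F f) = qtensor_map F F (qcoprod f)) \<and>
     (\<forall>f\<in>QSym. qcounit (F f) = qcounit f) \<and>
     (\<forall>S. qsym_antipode S \<longrightarrow> (\<forall>f\<in>QSym. F (S f) = S (F f)))"


section \<open>The isomorphism gamma and the map U on QSym\<close>

fun ab_mon :: "nat list \<Rightarrow> 'k::field abpoly" where
  "ab_mon [] = 0"
| "ab_mon [p] = (avar - bvar) ^ (p - 1)"
| "ab_mon (p # p' # ps) = (avar - bvar) ^ (p - 1) * bvar * ab_mon (p' # ps)"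

definition gamma :: "'k::field abpoly \<Rightarrow> 'k mps" where
  "gamma = (THE g. Vector_Spaces.linear pscale mscale g \<and>
     (\<forall>p\<in>compositions. p \<noteq> [] \<longrightarrow> g (ab_mon p) = M p))"

text \<open>Substitution of ab-polynomials for the letters. Used to show that \<open>gamma\<close> is well defined.\<close>

definition subst :: "(letter \<Rightarrow> 'k::field abpoly) \<Rightarrow> 'k abpoly \<Rightarrow> 'k abpoly" where
  "subst h = lin_ext pscale (\<lambda>w. \<Prod>x\<leftarrow>w. h x)"

global_interpretation pm: vector_space "pscale :: 'k::field \<Rightarrow> ('b \<Rightarrow>\<^sub>0 'k) \<Rightarrow> _"
  by (rule vector_space_pscale)

lemma linear_subst: "Vector_Spaces.linear pscale pscale (subst h)"
  unfolding subst_def by (rule linear_lin_ext[OF vector_space_pscale])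

lemma subst_single: "subst h (Poly_Mapping.single w c) = pscale c (\<Prod>x\<leftarrow>w. h x)"
  by (simp add: subst_def lin_ext_single[OF vector_space_pscale])

lemma pscale_conv: "pscale c (u :: 'b::monoid_add \<Rightarrow>\<^sub>0 'k::field) = Poly_Mapping.single 0 c * u"
  unfolding pscale_def by (rule mult_map_scale_conv_mult)

lemma single_central: "Poly_Mapping.single 0 c * u = u * (Poly_Mapping.single 0 c :: 'b::monoid_add \<Rightarrow>\<^sub>0 'k::field)"
proof -
  have "Poly_Mapping.single 0 c * (\<Sum>x\<in>A. Poly_Mapping.single x (f x)) =
    (\<Sum>x\<in>A. Poly_Mapping.single x (f x)) * Poly_Mapping.single 0 c" for A :: "'b set" and f :: "'b \<Rightarrow> 'k"
    by (simp add: sum_distrib_left sum_distrib_right mult_single mult.commute)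
  moreover have "u = (\<Sum>x\<in>Poly_Mapping.keys u. Poly_Mapping.single x (Poly_Mapping.lookup u x))"
    by (subst (1) poly_mapping_expand) (simp add: pscale_conv mult_single)
  ultimately show ?thesis by metis
qed

lemma pscale_mult_left: "pscale c (u :: 'b::monoid_add \<Rightarrow>\<^sub>0 'k::field) * v = pscale c (u * v)"
  by (simp add: pscale_conv mult.assoc)

lemma pscale_mult_right: "(u :: 'b::monoid_add \<Rightarrow>\<^sub>0 'k::field) * pscale c v = pscale c (u * v)"
  by (metis pscale_conv mult.assoc single_central)

lemma subst_mult: "subst h (u * v) = subst h u * subst h v"
proof -
  interpret S: Vector_Spaces.linear pscale pscale "subst h" by (rule linear_subst)
  have 1: "subst h (Poly_Mapping.single w 1 * Poly_Mapping.single w' 1) =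
    subst h (Poly_Mapping.single w 1) * subst h (Poly_Mapping.single w' 1)" for w w'
    by (simp add: mult_single subst_single plus_list_def)
  have 2: "subst h (Poly_Mapping.single w 1 * v) = subst h (Poly_Mapping.single w 1) * subst h v" for w
    by (subst (1 2) poly_mapping_expand[of v])
       (simp add: sum_distrib_left S.sum S.scale pscale_mult_right 1)
  show ?thesis
    by (subst (1 2) poly_mapping_expand[of u])
       (simp add: sum_distrib_right S.sum S.scale pscale_mult_left 2)
qed

lemma subst_one: "subst h 1 = 1"
  by (simp add: single_one[symmetric] subst_single zero_list_def del: single_one)

lemma subst_power: "subst h (u ^ n) = subst h u ^ n"
  by (induction n) (simp_all add: subst_one subst_mult)

lemma subst_avar: "subst h avar = h La" and subst_bvar: "subst h bvar = h Lb"
  by (simp_all add: avar_def bvar_def subst_single)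

lemma subst_prod_list: "subst h (\<Prod>x\<leftarrow>w. f x) = (\<Prod>x\<leftarrow>w. subst h (f x))"
  by (induction w) (simp_all add: subst_one subst_mult)

lemma subst_subst: "subst h (subst h' u) = subst (\<lambda>x. subst h (h' x)) u"
proof -
  interpret S: Vector_Spaces.linear pscale pscale "subst h" by (rule linear_subst)
  interpret S': Vector_Spaces.linear pscale pscale "subst h'" by (rule linear_subst)
  have "Vector_Spaces.linear pscale pscale (\<lambda>u. subst h (subst h' u))"
    unfolding Vector_Spaces.linear_iff using vector_space_pscale
    by (auto simp: S.add S'.add S.scale S'.scale)
  then have "(\<lambda>u. subst h (subst h' u)) = subst (\<lambda>x. subst h (h' x))"
    by (rule linear_eqI[OF _ linear_subst]) (simp add: subst_single subst_prod_list)
  then show ?thesis by metis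
qed

lemma prod_list_letters:
  "(\<Prod>x\<leftarrow>w. case x of La \<Rightarrow> avar | Lb \<Rightarrow> bvar) = (Poly_Mapping.single w 1 :: 'k::field abpoly)"
proof (induction w)
  case Nil
  then show ?case by (simp add: single_one[symmetric] zero_list_def del: single_one)
next
  case (Cons x w)
  then show ?case by (cases x) (simp_all add: avar_def bvar_def mult_single plus_list_def)
qed

lemma subst_id: "subst (\<lambda>x. case x of La \<Rightarrow> avar | Lb \<Rightarrow> bvar) u = u"
proof -
  have "subst (\<lambda>x. case x of La \<Rightarrow> avar | Lb \<Rightarrow> bvar) = (id :: 'a abpoly \<Rightarrow> _)"
    by (rule linear_eqI[OF linear_subst]) (auto simp: Vector_Spaces.linear_iff vector_space_pscale subst_single prod_list_letters)
  then show ?thesis by simp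
qed

abbreviation (input) sub_ab :: "letter \<Rightarrow> 'k::field abpoly" where
  "sub_ab x \<equiv> (case x of La \<Rightarrow> avar + bvar | Lb \<Rightarrow> bvar)"

abbreviation (input) sub_cb :: "letter \<Rightarrow> 'k::field abpoly" where
  "sub_cb x \<equiv> (case x of La \<Rightarrow> avar - bvar | Lb \<Rightarrow> bvar)"

lemma sub_inverse:
  fixes u :: "'a::field abpoly"
  shows "subst sub_cb (subst sub_ab u) = u" "subst sub_ab (subst sub_cb u) = u"
proof -
  interpret C: Vector_Spaces.linear pscale pscale "subst sub_cb :: 'a abpoly \<Rightarrow> _" by (rule linear_subst)
  interpret A: Vector_Spaces.linear pscale pscale "subst sub_ab :: 'a abpoly \<Rightarrow> _" by (rule linear_subst)
  have eq: "(\<lambda>x. subst sub_cb (sub_ab x)) = (\<lambda>x. case x of La \<Rightarrow> avar | Lb \<Rightarrow> (bvar :: 'a abpoly))"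
    "(\<lambda>x. subst sub_ab (sub_cb x)) = (\<lambda>x. case x of La \<Rightarrow> avar | Lb \<Rightarrow> (bvar :: 'a abpoly))"
    by (auto simp: fun_eq_iff C.add A.diff subst_avar subst_bvar split: letter.splits)
  show "subst sub_cb (subst sub_ab u) = u" by (simp only: subst_subst eq subst_id)
  show "subst sub_ab (subst sub_cb u) = u" by (simp only: subst_subst eq subst_id)
qed

fun comp_of :: "letter list \<Rightarrow> nat list" where
  "comp_of [] = [1]"
| "comp_of (La # w) = (hd (comp_of w) + 1) # tl (comp_of w)"
| "comp_of (Lb # w) = 1 # comp_of w"

lemma comp_of_ne: "comp_of w \<noteq> []"
  by (induction w rule: comp_of.induct) auto

lemma comp_of_comp: "comp_of w \<in> compositions"
proof (induction w rule: comp_of.induct)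
  case (2 w)
  then show ?case using comp_of_ne[of w] by (cases "comp_of w") (auto simp: compositions_def)
qed (auto simp: compositions_def)

lemma comp_of_surj: "p \<in> compositions \<Longrightarrow> p \<noteq> [] \<Longrightarrow> \<exists>w. comp_of w = p"
proof (induction "sum_list p" arbitrary: p rule: less_induct)
  case less
  then obtain x q where p: "p = x # q" and x: "x \<ge> 1" by (cases p) (auto simp: compositions_def)
  consider "x = 1" "q = []" | "x = 1" "q \<noteq> []" | "x \<ge> 2" using x by linarith
  then show ?case
  proof cases
    case 1
    then have "comp_of [] = p" by (simp add: p)
    then show ?thesis by blast
  next
    case 2
    have "\<exists>w. comp_of w = q" by (rule less.hyps) (use less.prems 2 in \<open>auto simp: p compositions_def\<close>)
    then obtain w where "comp_of w = q" by blast
    then have "comp_of (Lb # w) = p" by (simp add: p 2)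
    then show ?thesis by blast
  next
    case 3
    have "\<exists>w. comp_of w = (x - 1) # q" by (rule less.hyps) (use less.prems 3 in \<open>auto simp: p compositions_def\<close>)
    then obtain w where "comp_of w = (x - 1) # q" by blast
    then have "comp_of (La # w) = p" using 3 by (simp add: p)
    then show ?thesis by blast
  qed
qed

lemma comp_of_inj: "comp_of w = comp_of w' \<Longrightarrow> w = w'"
proof (induction w arbitrary: w' rule: comp_of.induct)
  have pos: "hd (comp_of v) \<noteq> 0" for v
    using comp_of_comp[of v] comp_of_ne[of v] by (cases "comp_of v") (auto simp: compositions_def)
  {
    case 1
    then show ?case using pos comp_of_ne comp_of_ne[symmetric]
      by (cases w' rule: comp_of.cases) auto
  next
    case (2 w)
    then show ?case using pos comp_of_ne list.expand[of "comp_of w"]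
      by (cases w' rule: comp_of.cases) auto
  next
    case (3 w)
    then show ?case using pos comp_of_ne comp_of_ne[symmetric]
      by (cases w' rule: comp_of.cases) auto
  }
qed

lemma ab_mon_Cons_La: "p \<in> compositions \<Longrightarrow> p \<noteq> [] \<Longrightarrow>
  ab_mon (Suc (hd p) # tl p) = (avar - bvar) * ab_mon p"
proof -
  assume p: "p \<in> compositions" "p \<noteq> []"
  then obtain n where "hd p = Suc n" by (cases p; cases "hd p") (auto simp: compositions_def)
  then show ?thesis using p by (cases p rule: ab_mon.cases) (auto simp: mult.assoc)
qed

lemma ab_mon_comp_of: "ab_mon (comp_of w) = subst sub_cb (Poly_Mapping.single w (1 :: 'k::field))"
proof (induction w rule: comp_of.induct)
  case (2 w)
  then show ?case by (simp add: ab_mon_Cons_La[OF comp_of_comp comp_of_ne] subst_single)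
next
  case (3 w)
  then show ?case using comp_of_ne[of w] by (cases "comp_of w") (auto simp: subst_single)
qed (simp add: subst_single)

definition gamma_explicit :: "'k::field abpoly \<Rightarrow> 'k mps" where
  "gamma_explicit u = lin_ext mscale (\<lambda>w. M (comp_of w)) (subst sub_ab u)"

lemma gamma_eq: "gamma = gamma_explicit"
  unfolding gamma_def
proof (rule the_equality)
  interpret L: Vector_Spaces.linear pscale mscale "lin_ext mscale (\<lambda>w. M (comp_of w))"
    by (rule linear_lin_ext[OF vector_space_mscale])
  interpret S: Vector_Spaces.linear pscale pscale "subst sub_ab :: 'a abpoly \<Rightarrow> _" by (rule linear_subst)
  have lin: "Vector_Spaces.linear pscale mscale (gamma_explicit :: 'a abpoly \<Rightarrow> _)"
    unfolding Vector_Spaces.linear_iff gamma_explicit_def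
    by (auto simp: vector_space_pscale vector_space_mscale S.add L.add S.scale L.scale)
  have val: "gamma_explicit (ab_mon p) = (M p :: 'a mps)" if p: "p \<in> compositions" "p \<noteq> []" for p
  proof -
    obtain w where "comp_of w = p" using comp_of_surj[OF p] by blast
    then show ?thesis unfolding gamma_explicit_def
      by (metis ab_mon_comp_of sub_inverse(2) lin_ext_single[OF vector_space_mscale] mps.scale_one)
  qed
  show "Vector_Spaces.linear pscale mscale (gamma_explicit :: 'a abpoly \<Rightarrow> _) \<and>
    (\<forall>p\<in>compositions. p \<noteq> [] \<longrightarrow> gamma_explicit (ab_mon p) = (M p :: 'a mps))"
    using lin val by blast
  fix g :: "'a abpoly \<Rightarrow> 'a mps"
  assume g: "Vector_Spaces.linear pscale mscale g \<and> (\<forall>p\<in>compositions. p \<noteq> [] \<longrightarrow> g (ab_mon p) = M p)"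
  interpret g: Vector_Spaces.linear pscale mscale g using g by blast
  interpret S': Vector_Spaces.linear pscale pscale "subst sub_cb :: 'a abpoly \<Rightarrow> _" by (rule linear_subst)
  interpret G: Vector_Spaces.linear pscale mscale "gamma_explicit :: 'a abpoly \<Rightarrow> _" by (rule lin)
  have "(\<lambda>u. g (subst sub_cb u)) = (\<lambda>u. gamma_explicit (subst sub_cb u))"
  proof (rule linear_eqI)
    show "Vector_Spaces.linear pscale mscale (\<lambda>u. g (subst sub_cb u))"
      "Vector_Spaces.linear pscale mscale (\<lambda>u. gamma_explicit (subst sub_cb u :: 'a abpoly))"
      unfolding Vector_Spaces.linear_iff
      by (auto simp: vector_space_pscale vector_space_mscale S'.add g.add S'.scale g.scale G.add G.scale)
    show "g (subst sub_cb (Poly_Mapping.single w 1)) = gamma_explicit (subst sub_cb (Poly_Mapping.single w 1))" for w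
      unfolding ab_mon_comp_of[symmetric] using g val comp_of_comp comp_of_ne by metis
  qed
  then show "g = gamma_explicit" by (metis sub_inverse(1) ext)
qed

lemma linear_gamma: "Vector_Spaces.linear pscale mscale gamma"
proof -
  interpret L: Vector_Spaces.linear pscale mscale "lin_ext mscale (\<lambda>w. M (comp_of w))"
    by (rule linear_lin_ext[OF vector_space_mscale])
  interpret S: Vector_Spaces.linear pscale pscale "subst sub_ab :: 'a abpoly \<Rightarrow> _" by (rule linear_subst)
  show ?thesis
    unfolding Vector_Spaces.linear_iff gamma_eq gamma_explicit_def
    by (auto simp: vector_space_pscale vector_space_mscale S.add L.add S.scale L.scale)
qed

lemma gamma_ab_mon:
  assumes "p \<in> compositions" "p \<noteq> []"
  shows "gamma (ab_mon p) = M p"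
proof -
  obtain w where "comp_of w = p" using comp_of_surj assms by blast
  then show ?thesis unfolding gamma_eq gamma_explicit_def
    by (metis ab_mon_comp_of sub_inverse(2) lin_ext_single[OF vector_space_mscale] mps.scale_one)
qed

lemma inj_gamma: "inj (gamma :: 'k::field abpoly \<Rightarrow> _)"
proof -
  let ?L = "lin_ext mscale (\<lambda>w. M (comp_of w)) :: 'k abpoly \<Rightarrow> _"
  have c: "coeff (?L u) (monom [0..<length (comp_of w)] (comp_of w)) = Poly_Mapping.lookup u w" for u w
  proof -
    have "coeff (?L u) (monom [0..<length (comp_of w)] (comp_of w)) =
      (\<Sum>x\<in>Poly_Mapping.keys u. if x = w then Poly_Mapping.lookup u x else 0)"
      unfolding lin_ext_def coeff_sum
      by (rule sum.cong) (auto simp: coeff_M comp_of_comp dest: comp_of_inj)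
    then show ?thesis by (simp add: in_keys_iff)
  qed
  have "inj ?L" by (rule injI, rule poly_mapping_eqI) (metis c)
  then show ?thesis unfolding gamma_eq gamma_explicit_def
    by (intro injI) (metis injD sub_inverse(1))
qed

lemma range_gamma: "range gamma = {f \<in> QSym. qcounit f = (0 :: 'k::field)}"
proof (intro equalityI subsetI)
  fix f :: "'k mps" assume "f \<in> range gamma"
  then obtain u where f: "f = lin_ext mscale (\<lambda>w. M (comp_of w)) (u :: 'k abpoly)"
    by (auto simp: gamma_eq gamma_explicit_def)
  have "f \<in> QSym" unfolding f lin_ext_def
    by (intro mps.subspace_sum mps.subspace_scale subspace_QSym M_in_QSym comp_of_comp)
  moreover have "coeff (M (comp_of w)) 0 = (0 :: 'k)" for w
    using coeff_M[OF comp_of_comp, of "[]" "[]" w] comp_of_ne[of w]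
    by (simp add: compositions_def monom_def)
  then have "qcounit f = 0" by (simp add: qcounit_def f lin_ext_def)
  ultimately show "f \<in> {f \<in> QSym. qcounit f = 0}" by blast
next
  fix f :: "'k mps" assume "f \<in> {f \<in> QSym. qcounit f = 0}"
  then have f: "f \<in> QSym" and 0: "coeff f 0 = 0" by (auto simp: qcounit_def)
  let ?c = "M_coords f"
  interpret G: Vector_Spaces.linear pscale mscale "gamma :: 'k abpoly \<Rightarrow> _" by (rule linear_gamma)
  have "Poly_Mapping.lookup ?c [] = 0"
    using coeff_lin_ext_M[OF keys_M_coords[OF f], of "[]" "[]"] 0 lin_ext_M_coords[OF f]
    by (simp add: compositions_def monom_def)
  then have g: "gamma (ab_mon p) = M p" if "p \<in> Poly_Mapping.keys ?c" for p
    using gamma_ab_mon keys_M_coords[OF f] that by (metis in_keys_iff subsetD)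
  have "f = (\<Sum>p\<in>Poly_Mapping.keys ?c. mscale (Poly_Mapping.lookup ?c p) (gamma (ab_mon p)))"
    by (subst lin_ext_M_coords[OF f, symmetric], unfold lin_ext_def) (rule sum.cong, simp_all add: g)
  also have "\<dots> = gamma (\<Sum>p\<in>Poly_Mapping.keys ?c. pscale (Poly_Mapping.lookup ?c p) (ab_mon p))"
    by (simp add: G.sum G.scale)
  finally show "f \<in> range gamma" by blast
qed

text \<open>\<open>inv gamma\<close> is meaningful on series without constant term by \<open>inj_gamma\<close> and \<open>range_gamma\<close>.\<close>

definition U_QSym :: "'k::field mps \<Rightarrow> 'k mps" where
  "U_QSym f = mscale (qcounit f) 1 + gamma (U_ab (inv gamma (f - mscale (qcounit f) 1)))"

end

theory Submission
  imports Defs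
begin

text \<open>
  On quasisymmetric functions the Tchebyshev transform of the second kind doubles the variables:
  \<open>U f (t\<^sub>1, t\<^sub>2, \<dots>) = f (t\<^sub>1, t\<^sub>1, t\<^sub>2, t\<^sub>2, \<dots>)\<close>. The operation on the right is a substitution, hence an
  algebra homomorphism on all power series (\<open>doubling_mult\<close>), and it preserves the constant term.

  The identification (\<open>U_QSym_eq_doubling\<close>) compares the values on the monomial basis. In the doubled
  alphabet, an increasing choice of variables for the parts of \<open>p\<close> meets each pair of equal variables
  in no part, in one part (in two ways) or in two consecutive parts (in one way). So doubling sends \<open>M p\<close>
  to the sum of \<open>M q\<close> over all ways to cut \<open>p\<close> into blocks of one or two consecutive parts, where \<open>q\<close>
  lists the block sums and each block of one part contributes a factor \<open>2\<close> (\<open>doubling_M\<close>).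

  On the side of ab-polynomials, put \<open>c = a - b\<close>. The coproduct is a Newtonian derivation, with
  \<open>\<Delta> b = 1 \<otimes> 1\<close> and \<open>\<Delta> c = 0\<close>, so it cuts a word in \<open>b\<close> and \<open>c\<close> at one letter \<open>b\<close>. The functional \<open>C\<close> is \<open>2\<close> on
  powers of \<open>c\<close>, is \<open>1\<close> on words with a single \<open>b\<close> and vanishes on other words in \<open>b\<close> and \<open>c\<close>: the factors \<open>\<nu>\<close>
  are the blocks of one or two parts. Formally, \<open>T = \<kappa> + \<nu> b T\<close> (\<open>T_map_eq\<close>) leads to
  the recursions \<open>U (c u) = c U u\<close> and \<open>U (b u) = 2 b U u + c W u\<close>, where the companion \<open>W\<close> of \<open>U\<close> holds
  the state "a block of two parts has been opened": \<open>W (c u) = c W u\<close> and \<open>W (b u) = b U u\<close>. They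
  reproduce the block expansion (\<open>U_ab_mon\<close>).

  Deconcatenation is compatible with the block expansion because the blocks of \<open>q @ q'\<close> are those of \<open>q\<close>
  followed by those of \<open>q'\<close> (\<open>lookup_merged_append\<close>). Compatibility with the antipode holds for every
  bialgebra endomorphism \<open>F\<close> (\<open>antipode_commutes\<close>): \<open>F \<circ> S\<close> and \<open>S \<circ> F\<close> are both left inverses of \<open>F\<close> for
  convolution, and the defining equation of a left inverse determines its values recursively.
\<close>

section \<open>Doubling the variables of a power series\<close>

text \<open>Exponent vectors are treated like lists: a new exponent of the first variable is put in front,
  and the old exponents move up by one variable.\<close>
definition exp_cons :: "nat \<Rightarrow> (nat \<Rightarrow>\<^sub>0 nat) \<Rightarrow> (nat \<Rightarrow>\<^sub>0 nat)" where
  "exp_cons e m = Abs_poly_mapping (case_nat e (Poly_Mapping.lookup m))"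

definition exp_tail :: "(nat \<Rightarrow>\<^sub>0 nat) \<Rightarrow> (nat \<Rightarrow>\<^sub>0 nat)" where
  "exp_tail m = Abs_poly_mapping (\<lambda>i. Poly_Mapping.lookup m (Suc i))"

text \<open>Identifying the variables with indices \<open>2 i\<close> and \<open>2 i + 1\<close> sends the monomial with exponent
  vector \<open>m\<close> to the one with exponent vector \<open>merge m\<close>.\<close>
definition merge :: "(nat \<Rightarrow>\<^sub>0 nat) \<Rightarrow> (nat \<Rightarrow>\<^sub>0 nat)" where
  "merge m = Abs_poly_mapping
     (\<lambda>i. Poly_Mapping.lookup m (2 * i) + Poly_Mapping.lookup m (Suc (2 * i)))"

lemma lookup_exp_cons: "Poly_Mapping.lookup (exp_cons e m) = case_nat e (Poly_Mapping.lookup m)"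
proof -
  have "{i. case_nat e (Poly_Mapping.lookup m) i \<noteq> 0} \<subseteq> insert 0 (Suc ` Poly_Mapping.keys m)"
  proof
    fix i assume "i \<in> {i. case_nat e (Poly_Mapping.lookup m) i \<noteq> 0}"
    then show "i \<in> insert 0 (Suc ` Poly_Mapping.keys m)" by (cases i) (auto simp: in_keys_iff)
  qed
  then have "finite {i. case_nat e (Poly_Mapping.lookup m) i \<noteq> 0}"
    by (rule finite_subset) auto
  then show ?thesis unfolding exp_cons_def by (rule lookup_Abs_poly_mapping)
qed

lemma lookup_exp_tail: "Poly_Mapping.lookup (exp_tail m) i = Poly_Mapping.lookup m (Suc i)"
proof -
  have "finite (Suc -` Poly_Mapping.keys m)"
    by (rule finite_vimageI) auto
  then have "finite {i. Poly_Mapping.lookup m (Suc i) \<noteq> 0}"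
    by (rule rev_finite_subset) (auto simp: in_keys_iff)
  then show ?thesis unfolding exp_tail_def by (simp add: lookup_Abs_poly_mapping)
qed

lemma lookup_merge:
  "Poly_Mapping.lookup (merge m) i = Poly_Mapping.lookup m (2 * i) + Poly_Mapping.lookup m (Suc (2 * i))"
proof -
  have "finite ((*) 2 -` Poly_Mapping.keys m \<union> (\<lambda>i. Suc (2 * i)) -` Poly_Mapping.keys m)"
    by (auto intro!: finite_vimageI injI)
  then have "finite {i. Poly_Mapping.lookup m (2 * i) + Poly_Mapping.lookup m (Suc (2 * i)) \<noteq> 0}"
    by (rule rev_finite_subset) (auto simp: in_keys_iff)
  then show ?thesis unfolding merge_def by (simp add: lookup_Abs_poly_mapping)
qed

lemma exp_cons_tail: "exp_cons (Poly_Mapping.lookup m 0) (exp_tail m) = m"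
  by (rule poly_mapping_eqI) (simp add: lookup_exp_cons lookup_exp_tail split: nat.splits)

lemma exp_cons_inject: "exp_cons e m = exp_cons e' m' \<longleftrightarrow> e = e' \<and> m = m'"
proof
  assume eq: "exp_cons e m = exp_cons e' m'"
  have "Poly_Mapping.lookup m i = Poly_Mapping.lookup m' i" for i
    using arg_cong[OF eq, of "\<lambda>m. Poly_Mapping.lookup m (Suc i)"] by (simp add: lookup_exp_cons)
  moreover have "e = e'"
    using arg_cong[OF eq, of "\<lambda>m. Poly_Mapping.lookup m 0"] by (simp add: lookup_exp_cons)
  ultimately show "e = e' \<and> m = m'" by (auto intro: poly_mapping_eqI)
qed simp

lemma exp_cons_eq_0: "exp_cons e m = 0 \<longleftrightarrow> e = 0 \<and> m = 0"
proof -
  have "exp_cons 0 0 = 0"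
    by (rule poly_mapping_eqI) (simp add: lookup_exp_cons split: nat.splits)
  then show ?thesis by (metis exp_cons_inject)
qed

text \<open>The finitely supported vectors are those obtained from \<open>0\<close> by finitely many steps \<open>exp_cons\<close>.\<close>
lemma exponent_induct [case_names zero exp_cons]:
  assumes "P 0" and "\<And>e m. P m \<Longrightarrow> P (exp_cons e m)"
  shows "P m"
proof -
  have "P m" if "Poly_Mapping.keys m \<subseteq> {..<n}" for n
    using that
  proof (induction n arbitrary: m)
    case 0
    then show ?case using assms(1) by simp
  next
    case (Suc n)
    have "Poly_Mapping.keys (exp_tail m) \<subseteq> {..<n}"
    proof
      fix i assume "i \<in> Poly_Mapping.keys (exp_tail m)"
      then have "Suc i \<in> Poly_Mapping.keys m" by (simp add: in_keys_iff lookup_exp_tail)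
      then show "i \<in> {..<n}" using Suc.prems by auto
    qed
    then have "P (exp_cons (Poly_Mapping.lookup m 0) (exp_tail m))"
      by (intro assms(2) Suc.IH)
    then show ?case by (simp add: exp_cons_tail)
  qed
  moreover obtain n where "Poly_Mapping.keys m \<subseteq> {..<n}"
    using finite_nat_set_iff_bounded[of "Poly_Mapping.keys m"] by auto
  ultimately show ?thesis by blast
qed

lemma merge_add: "merge (m + m') = merge m + merge m'"
  by (rule poly_mapping_eqI) (simp add: lookup_merge lookup_add)

lemma merge_exp_cons: "merge (exp_cons a (exp_cons b m)) = exp_cons (a + b) (merge m)"
proof (rule poly_mapping_eqI)
  fix i
  show "Poly_Mapping.lookup (merge (exp_cons a (exp_cons b m))) i =
    Poly_Mapping.lookup (exp_cons (a + b) (merge m)) i"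
    by (cases i) (simp_all add: lookup_merge lookup_exp_cons)
qed

lemma merge_eq_0: "merge m = 0 \<longleftrightarrow> m = 0"
proof
  assume 0: "merge m = 0"
  show "m = 0"
  proof (rule poly_mapping_eqI)
    fix i
    have "i = 2 * (i div 2) \<or> i = Suc (2 * (i div 2))" by presburger
    moreover have "Poly_Mapping.lookup m (2 * (i div 2)) + Poly_Mapping.lookup m (Suc (2 * (i div 2))) = 0"
      using lookup_merge[of m "i div 2"] 0 by simp
    ultimately show "Poly_Mapping.lookup m i = Poly_Mapping.lookup 0 i" by fastforce
  qed
next
  assume "m = 0"
  then show "merge m = 0" by (auto intro!: poly_mapping_eqI simp: lookup_merge)
qed

lemma merge_fibre_exp_cons:
  "{m'. merge m' = exp_cons e m} =
    (\<lambda>(a, m'). exp_cons a (exp_cons (e - a) m')) ` ({..e} \<times> {m'. merge m' = m})"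
proof (intro equalityI subsetI)
  fix m' assume "m' \<in> {m'. merge m' = exp_cons e m}"
  moreover obtain a b n where m': "m' = exp_cons a (exp_cons b n)" by (metis exp_cons_tail)
  ultimately have "e = a + b" "merge n = m" by (auto simp: merge_exp_cons exp_cons_inject)
  then show "m' \<in> (\<lambda>(a, m'). exp_cons a (exp_cons (e - a) m')) ` ({..e} \<times> {m'. merge m' = m})"
    unfolding m' by (intro image_eqI[of _ _ "(a, n)"]) auto
qed (auto simp: merge_exp_cons)

lemma finite_merge_fibre: "finite {m'. merge m' = m}"
  by (induction m rule: exponent_induct) (simp_all add: merge_eq_0 merge_fibre_exp_cons)

text \<open>The series \<open>f (t\<^sub>1, t\<^sub>1, t\<^sub>2, t\<^sub>2, \<dots>)\<close>; its coefficients are finite sums by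
  \<open>finite_merge_fibre\<close>.\<close>
definition doubling :: "'k::comm_ring_1 mps \<Rightarrow> 'k mps" where
  "doubling f = Mps (\<lambda>m. \<Sum>m' | merge m' = m. coeff f m')"

lemma coeff_doubling: "coeff (doubling f) m = (\<Sum>m' | merge m' = m. coeff f m')"
  by (simp add: doubling_def)

lemma coeff_doubling_0: "coeff (doubling f) 0 = coeff f 0"
  by (simp add: coeff_doubling merge_eq_0)

lemma coeff_doubling_exp_cons:
  "coeff (doubling f) (exp_cons e m) =
    (\<Sum>a\<le>e. \<Sum>m' | merge m' = m. coeff f (exp_cons a (exp_cons (e - a) m')))"
proof -
  have "inj_on (\<lambda>(a, m'). exp_cons a (exp_cons (e - a) m')) ({..e} \<times> {m'. merge m' = m})"
    by (auto simp: inj_on_def exp_cons_inject)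
  then show ?thesis
    unfolding coeff_doubling merge_fibre_exp_cons sum.cartesian_product
    by (subst sum.reindex) (simp_all add: case_prod_unfold)
qed

lemma doubling_add: "doubling (f + g) = doubling f + doubling g"
  by (rule mps_eqI) (simp add: coeff_doubling sum.distrib)

lemma doubling_mscale: "doubling (mscale c f) = mscale c (doubling f)"
  by (rule mps_eqI) (simp add: coeff_doubling sum_distrib_left)

lemma doubling_one: "doubling 1 = 1"
proof (rule mps_eqI)
  fix m
  have "coeff (doubling 1 :: 'a mps) m = (\<Sum>m' | merge m' = m. if m' = 0 then 1 else 0)"
    by (simp add: coeff_doubling)
  also have "\<dots> = (if merge 0 = m then 1 else 0)"
    by (simp add: sum.delta[OF finite_merge_fibre])
  also have "\<dots> = coeff (1 :: 'a mps) m"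
    using merge_eq_0[of 0] by auto
  finally show "coeff (doubling 1 :: 'a mps) m = coeff 1 m" .
qed

text \<open>Both sides sum \<open>coeff f m1 * coeff g m2\<close> over all pairs with \<open>merge m1 + merge m2 = m\<close>, since
  \<open>merge\<close> is additive.\<close>
lemma doubling_mult: "doubling (f * g) = doubling f * doubling g"
proof (rule mps_eqI)
  fix m
  let ?split = "\<lambda>m. {(m1, m2). m1 + m2 = (m :: nat \<Rightarrow>\<^sub>0 nat)}"
  let ?c = "\<lambda>(m1, m2). coeff f m1 * coeff g m2"
  have "coeff (doubling (f * g)) m = (\<Sum>m' | merge m' = m. sum ?c (?split m'))"
    by (simp add: coeff_doubling times_mps_def)
  also have "\<dots> = (\<Sum>(m', x)\<in>(SIGMA m':{m'. merge m' = m}. ?split m'). ?c x)"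
    by (rule sum.Sigma) (simp_all add: finite_merge_fibre finite_splits)
  also have "\<dots> = (\<Sum>(n, x)\<in>(SIGMA n:?split m. {m1. merge m1 = fst n} \<times> {m2. merge m2 = snd n}). ?c x)"
    by (rule sum.reindex_bij_witness
          [where i = "\<lambda>(n, m1, m2). (m1 + m2, m1, m2)" and j = "\<lambda>(m', m1, m2). ((merge m1, merge m2), m1, m2)"])
       (auto simp: merge_add)
  also have "\<dots> = (\<Sum>n\<in>?split m. sum ?c ({m1. merge m1 = fst n} \<times> {m2. merge m2 = snd n}))"
    by (rule sum.Sigma[symmetric]) (simp_all add: finite_merge_fibre finite_splits)
  also have "\<dots> = (\<Sum>n\<in>?split m. coeff (doubling f) (fst n) * coeff (doubling g) (snd n))"
    by (simp only: coeff_doubling sum_product sum.cartesian_product)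
  also have "\<dots> = coeff (doubling f * doubling g) m"
    by (simp add: times_mps_def case_prod_beta)
  finally show "coeff (doubling (f * g)) m = coeff (doubling f * doubling g) m" .
qed

lemma monom_Nil: "monom js [] = 0"
  by (simp add: monom_def)

lemma exp_cons_monom:
  assumes "length is = length p"
  shows "exp_cons 0 (monom is p) = monom (map Suc is) p"
    and "exp_cons e (monom is p) = monom (0 # map Suc is) (e # p)"
proof -
  have add: "exp_cons (a + b) (m + m') = exp_cons a m + exp_cons b m'" for a b m m'
    by (rule poly_mapping_eqI) (simp add: lookup_exp_cons lookup_add split: nat.splits)
  have zero: "exp_cons 0 0 = 0" by (simp add: exp_cons_eq_0)
  have single: "exp_cons 0 (Poly_Mapping.single i x) = Poly_Mapping.single (Suc i) x" for i x
    by (rule poly_mapping_eqI) (simp add: lookup_exp_cons lookup_single when_def split: nat.splits)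
  have sum: "exp_cons 0 (sum f A) = (\<Sum>x\<in>A. exp_cons 0 (f x))" for f :: "nat \<Rightarrow> _" and A
    by (induction A rule: infinite_finite_induct) (use add[of 0 0] in \<open>simp_all add: zero\<close>)
  show 0: "exp_cons 0 (monom is p) = monom (map Suc is) p"
    unfolding monom_def sum by (rule sum.cong) (use assms in \<open>simp_all add: single\<close>)
  have "exp_cons e 0 = Poly_Mapping.single 0 e"
    by (rule poly_mapping_eqI) (simp add: lookup_exp_cons lookup_single when_def split: nat.splits)
  then have "exp_cons e (monom is p) = Poly_Mapping.single 0 e + exp_cons 0 (monom is p)"
    using add[of e 0 0 "monom is p"] by simp
  also have "\<dots> = monom (0 # map Suc is) (e # p)"
    unfolding 0 by (simp add: monom_def sum.lessThan_Suc_shift del: sum.lessThan_Suc)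
  finally show "exp_cons e (monom is p) = monom (0 # map Suc is) (e # p)" .
qed

lemma coeff_M_zero:
  assumes "p \<in> compositions"
  shows "coeff (M p) 0 = (if p = [] then 1 else 0)"
  using coeff_M[OF assms, of "[]" "[]"] by (simp add: compositions_def monom_Nil)

text \<open>A strictly increasing choice of indices either avoids the first variable or uses it for the
  first part.\<close>

lemma coeff_M_exp_cons:
  assumes p: "p \<in> compositions"
  shows "coeff (M p :: 'k::field mps) (exp_cons 0 m) = coeff (M p :: 'k mps) m"
    and "e > 0 \<Longrightarrow> coeff (M p :: 'k mps) (exp_cons e m) =
      (case p of [] \<Rightarrow> 0 | x # r \<Rightarrow> if x = e then coeff (M r) m else 0)"
proof -
  obtain "is" q where m: "sorted_wrt (<) is" "length is = length q" "q \<in> compositions" "m = monom is q"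
    using monom_exists .
  have c: "coeff (M p :: 'k mps) (monom js q) = (if p = q then 1 else 0)"
    if "p \<in> compositions" "q \<in> compositions" "sorted_wrt (<) js" "length js = length q" for p q js
    using that by (rule coeff_M)
  have "sorted_wrt (<) (map Suc is)" using m(1) by (simp add: sorted_wrt_map)
  then show "coeff (M p :: 'k mps) (exp_cons 0 m) = coeff (M p :: 'k mps) m"
    using c[OF p m(3,1,2)] c[OF p m(3), of "map Suc is"] m(2)
    by (simp add: m(4) exp_cons_monom(1))
  assume e: "e > 0"
  have "sorted_wrt (<) (0 # map Suc is)" using m(1) by (simp add: sorted_wrt_map)
  moreover have "e # q \<in> compositions" using m(3) e by (simp add: compositions_def)
  ultimately have "coeff (M p :: 'k mps) (exp_cons e m) = (if p = e # q then 1 else 0)"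
    using c[OF p, of "e # q" "0 # map Suc is"] m(2) by (simp add: m(4) exp_cons_monom(2))
  also have "\<dots> = (case p of [] \<Rightarrow> 0 | x # r \<Rightarrow> if x = e then coeff (M r) m else 0)"
    using p c[OF _ m(3,1,2)] by (auto simp: m(4) compositions_def split: list.splits)
  finally show "coeff (M p :: 'k mps) (exp_cons e m) =
      (case p of [] \<Rightarrow> 0 | x # r \<Rightarrow> if x = e then coeff (M r) m else 0)" .
qed

section \<open>Products of quasisymmetric functions\<close>

definition mon_degree :: "(nat \<Rightarrow>\<^sub>0 nat) \<Rightarrow> nat" where
  "mon_degree m = (\<Sum>i\<in>Poly_Mapping.keys m. Poly_Mapping.lookup m i)"

lemma mon_degree_add: "mon_degree (m + m') = mon_degree m + mon_degree m'"
proof -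
  let ?S = "Poly_Mapping.keys m \<union> Poly_Mapping.keys m'"
  have *: "mon_degree n = (\<Sum>i\<in>?S. Poly_Mapping.lookup n i)" if "Poly_Mapping.keys n \<subseteq> ?S" for n
    unfolding mon_degree_def by (rule sum.mono_neutral_left) (use that in \<open>auto simp: in_keys_iff\<close>)
  have "Poly_Mapping.keys (m + m') \<subseteq> ?S" by (rule keys_add)
  then show ?thesis by (simp add: * lookup_add sum.distrib)
qed

text \<open>Quasisymmetry speaks of compositions only. Deleting zero exponents extends it to exponent
  lists with zeros (\<open>QSym_coeff_relabel\<close>), which occur in the factors of a monomial.\<close>
lemma monom_drop_zeros:
  assumes "sorted_wrt (<) is" "length is = length q"
  defines "is' \<equiv> map fst (filter (\<lambda>(i, e). e \<noteq> 0) (zip is q))"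
  shows "sorted_wrt (<) is'" and "monom is q = monom is' (filter (\<lambda>e. e \<noteq> 0) q)"
    and "length is' = length (filter (\<lambda>e. e \<noteq> 0) q)"
proof -
  have monom_Cons: "monom (i # is) (e # q) = Poly_Mapping.single i e + monom is q" for i e "is" q
    by (simp add: monom_def sum.lessThan_Suc_shift del: sum.lessThan_Suc)
  have sub: "set (map fst (filter P (zip is q))) \<subseteq> set is" for P "is" and q :: "nat list"
    by (auto dest: set_zip_leftD)
  from assms(2,1) have "sorted_wrt (<) is' \<and> monom is q = monom is' (filter (\<lambda>e. e \<noteq> 0) q) \<and>
      length is' = length (filter (\<lambda>e. e \<noteq> 0) q)"
    unfolding is'_def
  proof (induction "is" q rule: list_induct2)
    case (Cons i "is" e q)
    then show ?case using sub[of "\<lambda>(i, e). e \<noteq> 0" "is" q]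
      by (cases "e = 0") (auto simp: monom_Cons)
  qed simp
  then show "sorted_wrt (<) is'" and "monom is q = monom is' (filter (\<lambda>e. e \<noteq> 0) q)"
    and "length is' = length (filter (\<lambda>e. e \<noteq> 0) q)" by blast+
qed

lemma QSym_coeff_relabel:
  assumes f: "f \<in> QSym"
    and "is": "sorted_wrt (<) is" "length is = length q"
    and js: "sorted_wrt (<) js" "length js = length q"
  shows "coeff f (monom is q) = coeff f (monom js q)"
proof -
  let ?q = "filter (\<lambda>e. e \<noteq> 0) q"
  have "?q \<in> compositions" by (auto simp: compositions_def)
  then show ?thesis
    using f monom_drop_zeros[OF "is"] monom_drop_zeros[OF js]
    unfolding QSym_def mem_Collect_eq by (metis (no_types, lifting))
qed

lemma monom_lookup_self:
  assumes "sorted_wrt (<) is" "Poly_Mapping.keys m \<subseteq> set is"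
  shows "monom is (map (Poly_Mapping.lookup m) is) = m"
proof (rule poly_mapping_eqI)
  fix x
  let ?q = "map (Poly_Mapping.lookup m) is"
  show "Poly_Mapping.lookup (monom is ?q) x = Poly_Mapping.lookup m x"
  proof (cases "x \<in> set is")
    case True
    then obtain j where "j < length ?q" "x = is ! j" by (metis in_set_conv_nth length_map)
    then show ?thesis using lookup_monom[OF assms(1), of ?q j] by simp
  next
    case False
    then show ?thesis using lookup_monom_notin[of "is" ?q x] assms(2) by (auto simp: in_keys_iff)
  qed
qed

lemma map_lookup_monom:
  assumes "sorted_wrt (<) is" "length is = length q"
  shows "map (Poly_Mapping.lookup (monom is q)) is = q"
  by (rule nth_equalityI) (use assms lookup_monom[OF assms] in auto)

lemma monom_add:
  assumes "length q = length q'"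
  shows "monom is (map2 (+) q q') = monom is q + monom is q'"
  using assms by (simp add: monom_def sum.distrib[symmetric] single_add)

lemma keys_monom_subset: "length is = length q \<Longrightarrow> Poly_Mapping.keys (monom is q) \<subseteq> set is"
  using lookup_monom_notin by (fastforce simp: in_keys_iff)

text \<open>Moving the exponents from the variables \<open>is\<close> to the variables \<open>js\<close> is a bijection between the
  factorizations of \<open>monom is p\<close> and those of \<open>monom js p\<close>: the factors of \<open>monom is p\<close> involve no other
  variables than \<open>is\<close>.\<close>
lemma splits_relabel:
  assumes "is": "sorted_wrt (<) is" "length is = length p"
    and js: "sorted_wrt (<) js" "length js = length p"
    and m: "m1 + m2 = monom is p"
  defines "r \<equiv> \<lambda>m. monom js (map (Poly_Mapping.lookup m) is)"
  shows "r m1 + r m2 = monom js p"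
    and "monom is (map (Poly_Mapping.lookup (r m1)) js) = m1"
    and "monom is (map (Poly_Mapping.lookup (r m2)) js) = m2"
proof -
  have keys: "Poly_Mapping.keys m1 \<subseteq> set is" "Poly_Mapping.keys m2 \<subseteq> set is"
    using keys_monom_subset[OF "is"(2)] unfolding m[symmetric]
    by (auto simp: in_keys_iff subset_iff lookup_add)
  have len: "length js = length (map (Poly_Mapping.lookup m) is)" for m :: "nat \<Rightarrow>\<^sub>0 nat"
    using "is" js by simp
  show "monom is (map (Poly_Mapping.lookup (r m1)) js) = m1"
       "monom is (map (Poly_Mapping.lookup (r m2)) js) = m2"
    by (simp_all only: r_def map_lookup_monom[OF js(1) len] monom_lookup_self[OF "is"(1)] keys)
  have "r m1 + r m2 = monom js (map (Poly_Mapping.lookup (m1 + m2)) is)"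
    unfolding r_def plus_poly_mapping.rep_eq
    by (subst monom_add[symmetric]) (simp_all add: map2_map_map)
  also have "\<dots> = monom js p" by (simp only: m map_lookup_monom[OF "is"])
  finally show "r m1 + r m2 = monom js p" .
qed

lemma QSym_mult:
  assumes f: "f \<in> QSym" and g: "g \<in> QSym"
  shows "f * g \<in> QSym"
  unfolding QSym_def
proof (intro CollectI conjI ballI allI impI)
  from f g obtain d e where
    d: "coeff f m \<noteq> 0 \<longrightarrow> mon_degree m \<le> d" and
    e: "coeff g m \<noteq> 0 \<longrightarrow> mon_degree m \<le> e" for m
    unfolding QSym_def mon_degree_def by blast
  have "mon_degree m \<le> d + e" if nz: "coeff (f * g) m \<noteq> 0" for m
  proof -
    obtain x where "x \<in> {(m1, m2). m1 + m2 = m}" "(case x of (m1, m2) \<Rightarrow> coeff f m1 * coeff g m2) \<noteq> 0"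
      using nz unfolding times_mps_def coeff_Mps by (rule sum.not_neutral_contains_not_neutral)
    then obtain m1 m2 where "m = m1 + m2" "coeff f m1 \<noteq> 0" "coeff g m2 \<noteq> 0" by auto
    then show ?thesis using d[of m1] e[of m2] by (simp add: mon_degree_add)
  qed
  then show "\<exists>d. \<forall>m. coeff (f * g) m \<noteq> 0 \<longrightarrow> (\<Sum>i\<in>Poly_Mapping.keys m. Poly_Mapping.lookup m i) \<le> d"
    unfolding mon_degree_def by blast
next
  fix p "is" js :: "nat list"
  assume "sorted_wrt (<) is \<and> sorted_wrt (<) js \<and> length is = length p \<and> length js = length p"
  then have "is": "sorted_wrt (<) is" "length is = length p"
    and js: "sorted_wrt (<) js" "length js = length p" by auto
  let ?r = "\<lambda>is js (m1 :: nat \<Rightarrow>\<^sub>0 nat, m2 :: nat \<Rightarrow>\<^sub>0 nat). (monom js (map (Poly_Mapping.lookup m1) is), monom js (map (Poly_Mapping.lookup m2) is))"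
  have relabel: "coeff (h :: 'a mps) (monom js (map (Poly_Mapping.lookup m) is)) = coeff h m"
    if "h \<in> QSym" "monom is (map (Poly_Mapping.lookup (monom js (map (Poly_Mapping.lookup m) is))) js) = m" for h and m :: "nat \<Rightarrow>\<^sub>0 nat"
  proof -
    let ?q = "map (Poly_Mapping.lookup m) is"
    have len: "length js = length ?q" "length is = length ?q" using "is" js by simp_all
    have "monom is ?q = m"
      using that(2) unfolding map_lookup_monom[OF js(1) len(1)] .
    then show ?thesis
      using QSym_coeff_relabel[OF that(1) js(1) len(1) "is"(1) len(2)] by (simp only:)
  qed
  show "coeff (f * g) (monom is p) = coeff (f * g) (monom js p)"
    unfolding times_mps_def coeff_Mps
  proof (rule sum.reindex_bij_witness[where j = "?r is js" and i = "?r js is"])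
    fix x assume "x \<in> {(m1, m2). m1 + m2 = monom is p}"
    then obtain m1 m2 where x: "x = (m1, m2)" and m: "m1 + m2 = monom is p" by auto
    note relab = splits_relabel[OF "is" js m]
    show "?r js is (?r is js x) = x" by (simp only: x prod.case relab)
    show "?r is js x \<in> {(m1, m2). m1 + m2 = monom js p}"
      by (simp only: x prod.case mem_Collect_eq relab)
    show "(case ?r is js x of (m1, m2) \<Rightarrow> coeff f m1 * coeff g m2) = (case x of (m1, m2) \<Rightarrow> coeff f m1 * coeff g m2)"
      by (simp only: x prod.case relabel[OF f relab(2)] relabel[OF g relab(3)])
  next
    fix x assume "x \<in> {(m1, m2). m1 + m2 = monom js p}"
    then obtain m1 m2 where x: "x = (m1, m2)" and m: "m1 + m2 = monom js p" by auto
    note relab = splits_relabel[OF js "is" m]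
    show "?r is js (?r js is x) = x" by (simp only: x prod.case relab)
    show "?r js is x \<in> {(m1, m2). m1 + m2 = monom is p}"
      by (simp only: x prod.case mem_Collect_eq relab)
  qed
qed

section \<open>Doubling a monomial quasisymmetric function\<close>

lemma lookup_mult_word:
  "Poly_Mapping.lookup (Poly_Mapping.single [x] 1 * d) q =
    (case q of [] \<Rightarrow> 0 | y # r \<Rightarrow> if x = y then Poly_Mapping.lookup d r else (0 :: 'k::field))"
proof -
  interpret L: Vector_Spaces.linear pscale "(*)" "\<lambda>d. Poly_Mapping.lookup (Poly_Mapping.single [x] (1::'k) * d) q"
    by (auto simp: Vector_Spaces.linear_iff vector_space_pscale vector_space_mult distrib_left lookup_add pscale_mult_right)
  have "(\<lambda>d. Poly_Mapping.lookup (Poly_Mapping.single [x] 1 * d) q) =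
    (\<lambda>d. case q of [] \<Rightarrow> 0 | y # r \<Rightarrow> if x = y then Poly_Mapping.lookup d r else (0 :: 'k))"
  proof (rule linear_eqI[OF L.linear_axioms])
    show "Vector_Spaces.linear pscale (*) (\<lambda>d. case q of [] \<Rightarrow> 0 | y # r \<Rightarrow> if x = y then Poly_Mapping.lookup d r else (0 :: 'k))"
      by (auto simp: Vector_Spaces.linear_iff vector_space_pscale vector_space_mult lookup_add split: list.splits)
  qed (auto simp: mult_single plus_list_def lookup_single when_def split: list.splits)
  then show ?thesis by metis
qed

text \<open>The block expansion of \<open>p\<close>, in the coordinates of the basis \<open>M\<close>: the formal sum of the lists of block
  sums, over all ways to cut \<open>p\<close> into blocks of one part (weight \<open>2\<close>) or two consecutive parts
  (weight \<open>1\<close>). The product is that of the free algebra on positive integers, so that multiplication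
  by \<open>[x]\<close> from the left puts \<open>x\<close> in front.\<close>
fun merged :: "nat list \<Rightarrow> (nat list \<Rightarrow>\<^sub>0 'k::field)" where
  "merged [] = 1"
| "merged [x] = pscale 2 (Poly_Mapping.single [x] 1)"
| "merged (x # y # r) = pscale 2 (Poly_Mapping.single [x] 1 * merged (y # r)) + Poly_Mapping.single [x + y] 1 * merged r"

lemma lookup_one_list: "Poly_Mapping.lookup (1 :: 'a list \<Rightarrow>\<^sub>0 'k::field) q = (if q = [] then 1 else 0)"
  by (simp add: lookup_one zero_list_def when_def)

lemma lookup_merged_Nil: "Poly_Mapping.lookup (merged p) [] = (if p = [] then 1 else 0)"
  by (cases p rule: merged.cases) (simp_all add: lookup_one_list lookup_single lookup_add lookup_mult_word)

lemma lookup_merged_Cons: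
  "Poly_Mapping.lookup (merged p :: nat list \<Rightarrow>\<^sub>0 'k::field) (e # q) =
    (case p of [] \<Rightarrow> 0 | x # p' \<Rightarrow> (if x = e then 2 * Poly_Mapping.lookup (merged p') q else 0) +
      (case p' of [] \<Rightarrow> 0 | y # r \<Rightarrow> if x + y = e then Poly_Mapping.lookup (merged r) q else 0))"
  by (cases p rule: merged.cases)
     (auto simp: lookup_one_list lookup_single lookup_add lookup_mult_word when_def)

declare merged.simps [simp del]

lemma keys_merged: "p \<in> compositions \<Longrightarrow> Poly_Mapping.keys (merged p :: nat list \<Rightarrow>\<^sub>0 'k::field) \<subseteq> compositions"
proof
  fix q
  assume "p \<in> compositions" "q \<in> Poly_Mapping.keys (merged p :: nat list \<Rightarrow>\<^sub>0 'k)"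
  then show "q \<in> compositions"
  proof (induction q arbitrary: p)
    case (Cons e q)
    then have "p \<in> compositions" and nz: "Poly_Mapping.lookup (merged p :: nat list \<Rightarrow>\<^sub>0 'k) (e # q) \<noteq> 0"
      by (auto simp: in_keys_iff)
    then have "e > 0"
      by (auto simp: lookup_merged_Cons compositions_def split: list.splits if_splits)
    moreover have "\<exists>r\<in>compositions. Poly_Mapping.lookup (merged r :: nat list \<Rightarrow>\<^sub>0 'k) q \<noteq> 0"
    proof (rule ccontr)
      assume "\<not> ?thesis"
      then have "Poly_Mapping.lookup (merged r :: nat list \<Rightarrow>\<^sub>0 'k) q = 0" if "\<forall>x\<in>set r. 1 \<le> x" for r
        using that by (auto simp: compositions_def)
      with nz \<open>p \<in> compositions\<close> show False
        by (auto simp: lookup_merged_Cons compositions_def split: list.splits if_splits)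
    qed
    ultimately obtain r where "r \<in> compositions" "Poly_Mapping.lookup (merged r :: nat list \<Rightarrow>\<^sub>0 'k) q \<noteq> 0" "e > 0"
      by blast
    with Cons.IH[of r] show ?case by (simp add: in_keys_iff compositions_def)
  qed (simp add: compositions_def)
qed

definition M_comb :: "(nat list \<Rightarrow>\<^sub>0 'k::field) \<Rightarrow> 'k mps" where
  "M_comb = lin_ext mscale M"

lemma linear_M_comb: "Vector_Spaces.linear pscale mscale M_comb"
  unfolding M_comb_def by (rule linear_lin_ext[OF vector_space_mscale])

text \<open>Both sides obey the same recursion on the first nonzero exponent \<open>e\<close>, which is the first
  entry of \<open>q\<close>. In \<open>M p\<close>, the two variables merged into the first one take up either the first
  part of \<open>p\<close>, carried by one of the two, or the first two parts, one each.\<close>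

lemma coeff_doubling_M:
  assumes p: "p \<in> compositions" and q: "q \<in> compositions"
    and js: "sorted_wrt (<) js" "length js = length q"
  shows "coeff (doubling (M p)) (monom js q) = (Poly_Mapping.lookup (merged p) q :: 'k::field)"
proof -
  have "\<exists>is q. sorted_wrt (<) is \<and> length is = length q \<and> q \<in> compositions \<and> m = monom is q \<and>
    (\<forall>p\<in>compositions. coeff (doubling (M p)) m = (Poly_Mapping.lookup (merged p) q :: 'k))" for m
  proof (induction m rule: exponent_induct)
    case zero
    show ?case
      by (rule exI[of _ "[]"], rule exI[of _ "[]"])
         (simp add: compositions_def monom_Nil coeff_doubling_0 coeff_M_zero lookup_merged_Nil)
  next
    case (exp_cons e m)
    then obtain "is" q where m: "sorted_wrt (<) is" "length is = length q" "q \<in> compositions" "m = monom is q"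
      and IH: "\<And>p. p \<in> compositions \<Longrightarrow> coeff (doubling (M p)) m = (Poly_Mapping.lookup (merged p) q :: 'k)"
      by blast
    show ?case
    proof (cases "e = 0")
      case True
      then have "coeff (doubling (M p)) (exp_cons e m) = (Poly_Mapping.lookup (merged p) q :: 'k)"
        if "p \<in> compositions" for p
        unfolding IH[OF that, symmetric] using that
        by (simp add: coeff_doubling_exp_cons coeff_M_exp_cons(1) coeff_doubling[of _ m])
      moreover have "exp_cons e m = monom (map Suc is) q" "sorted_wrt (<) (map Suc is)"
        using m True by (simp_all add: exp_cons_monom(1) sorted_wrt_map)
      ultimately show ?thesis using m by (metis length_map)
    next
      case False
      have "coeff (doubling (M p)) (exp_cons e m) = (Poly_Mapping.lookup (merged p) (e # q) :: 'k)"
        if p: "p \<in> compositions" for p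
      proof -
        let ?g = "\<lambda>a. \<Sum>m' | merge m' = m. coeff (M p :: 'k mps) (exp_cons a (exp_cons (e - a) m'))"
        have tail: "coeff (doubling (M r)) m = (\<Sum>m' | merge m' = m. coeff (M r :: 'k mps) m')" for r
          by (rule coeff_doubling)
        show ?thesis
        proof (cases p)
          case Nil
          have "coeff (M [] :: 'k mps) (exp_cons a (exp_cons (e - a) m')) = 0" if "a \<le> e" for a m'
            using that False p by (cases "a = 0") (simp_all add: coeff_M_exp_cons compositions_def)
          then show ?thesis by (simp add: Nil coeff_doubling_exp_cons lookup_merged_Cons)
        next
          case (Cons x p')
          have p': "p' \<in> compositions" and x: "x > 0" using p Cons by (auto simp: compositions_def)
          have "?g 0 = (if x = e then coeff (doubling (M p')) m else 0)"
            using p False by (simp add: Cons coeff_M_exp_cons tail)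
          moreover have "?g e = (if x = e then coeff (doubling (M p')) m else 0)"
            using p p' False by (simp add: Cons coeff_M_exp_cons tail)
          \<comment> \<open>Both variables of the pair occur only if they carry exactly the first two parts.\<close>
          moreover have "(\<Sum>a\<in>{0<..<e}. ?g a) = (case p' of [] \<Rightarrow> 0 | y # r \<Rightarrow>
            if x + y = e then coeff (doubling (M r)) m else 0)"
          proof -
            have "(\<Sum>a\<in>{0<..<e}. ?g a) = (\<Sum>a\<in>{0<..<e}. if x = a then
              (case p' of [] \<Rightarrow> 0 | y # r \<Rightarrow> if y = e - x then coeff (doubling (M r)) m else 0) else 0)"
              using p p' by (intro sum.cong) (auto simp: Cons coeff_M_exp_cons(2) tail split: list.splits)
            also have "\<dots> = (case p' of [] \<Rightarrow> 0 | y # r \<Rightarrow> if x + y = e then coeff (doubling (M r)) m else 0)"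
              using x p' by (auto simp: compositions_def split: list.splits)
            finally show ?thesis .
          qed
          moreover have "coeff (doubling (M p)) (exp_cons e m) = ?g 0 + ?g e + (\<Sum>a\<in>{0<..<e}. ?g a)"
          proof -
            have "{..e} = insert 0 (insert e {0<..<e})" by auto
            then show ?thesis using False by (simp add: coeff_doubling_exp_cons add.assoc)
          qed
          ultimately show ?thesis
            using p' by (auto simp: Cons lookup_merged_Cons IH compositions_def split: list.splits)
        qed
      qed
      moreover have "exp_cons e m = monom (0 # map Suc is) (e # q)" "sorted_wrt (<) (0 # map Suc is)"
        using m by (simp_all add: exp_cons_monom(2) sorted_wrt_map)
      moreover have "e # q \<in> compositions" using m(3) False by (simp add: compositions_def)
      moreover have "length (0 # map Suc is) = length (e # q)" using m by simp
      ultimately show ?thesis by blast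
    qed
  qed
  then obtain "is" r where "sorted_wrt (<) is" "length is = length r" "r \<in> compositions" "monom js q = monom is r"
    and coeff: "coeff (doubling (M p)) (monom js q) = (Poly_Mapping.lookup (merged p) r :: 'k)"
    using p by blast
  then have "q = r" using monom_unique[OF js q] by blast
  then show ?thesis using coeff by simp
qed

lemma doubling_M:
  assumes p: "p \<in> compositions"
  shows "doubling (M p) = M_comb (merged p)"
proof (rule mps_eqI)
  fix m
  obtain "is" q where "sorted_wrt (<) is" "length is = length q" "q \<in> compositions" "m = monom is q"
    using monom_exists .
  then show "coeff (doubling (M p) :: 'a mps) m = coeff (M_comb (merged p)) m"
    using coeff_lin_ext_M[OF keys_merged[OF p], where ?'k = 'a] by (simp add: M_comb_def coeff_doubling_M p)
qed

section \<open>The Tchebyshev transform by recursion on the first letter\<close>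

abbreviation word :: "'a list \<Rightarrow> ('a list \<Rightarrow>\<^sub>0 'k::field)" where
  "word w \<equiv> Poly_Mapping.single w 1"

abbreviation plin :: "(('a \<Rightarrow>\<^sub>0 'k::field) \<Rightarrow> ('b \<Rightarrow>\<^sub>0 'k)) \<Rightarrow> bool" where
  "plin \<equiv> Vector_Spaces.linear pscale pscale"

lemma plin_iff: "plin f \<longleftrightarrow> (\<forall>u v. f (u + v) = f u + f v) \<and> (\<forall>c u. f (pscale c u) = pscale c (f u))"
  by (simp add: Vector_Spaces.linear_iff vector_space_pscale)

lemma plin_simps:
  assumes "plin f"
  shows "f (u + v) = f u + f v" "f (u - v) = f u - f v" "f (pscale c u) = pscale c (f u)" "f 0 = 0"
    "f (\<Sum>x\<in>A. g x) = (\<Sum>x\<in>A. f (g x))"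
proof -
  interpret Vector_Spaces.linear pscale pscale f by fact
  show "f (u + v) = f u + f v" "f (u - v) = f u - f v" "f (pscale c u) = pscale c (f u)" "f 0 = 0"
    "f (\<Sum>x\<in>A. g x) = (\<Sum>x\<in>A. f (g x))"
    by (rule add diff scale zero sum)+
qed

lemma plin_lin_ext: "plin (lin_ext pscale f)"
  by (rule linear_lin_ext[OF vector_space_pscale])

lemma plin_compose: "plin f \<Longrightarrow> plin g \<Longrightarrow> plin (\<lambda>u. f (g u))"
  by (simp add: plin_iff)

lemma plin_add: "plin f \<Longrightarrow> plin g \<Longrightarrow> plin (\<lambda>u. f u + g u)"
  and plin_diff: "plin f \<Longrightarrow> plin g \<Longrightarrow> plin (\<lambda>u. f u - g u)"
  and plin_pscale: "plin f \<Longrightarrow> plin (\<lambda>u. pscale c (f u))"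
  by (simp_all add: plin_iff pm.scale_right_distrib pm.scale_right_diff_distrib mult.commute)

lemma plin_mult_left: "plin f \<Longrightarrow> plin (\<lambda>u. y * f u)"
  and plin_mult_right: "plin f \<Longrightarrow> plin (\<lambda>u. f u * y)" for y :: "'b::monoid_add \<Rightarrow>\<^sub>0 'k::field"
  by (simp_all add: plin_iff distrib_left distrib_right pscale_mult_left pscale_mult_right)

lemma plin_id: "plin (\<lambda>u. u)"
  and plin_zero: "plin (\<lambda>u. 0)"
  by (simp_all add: plin_iff)

lemmas plin_intros = plin_lin_ext plin_add plin_diff plin_pscale plin_mult_left plin_mult_right plin_id plin_zero

lemma plin_eqI:
  assumes "plin f" "plin g" "\<And>x. f (Poly_Mapping.single x 1) = g (Poly_Mapping.single x 1)"
  shows "f u = g u"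
  using linear_eqI[OF assms] by simp

lemma word_mult: "word (x # w) = word [x] * word w"
  by (simp add: mult_single plus_list_def)

lemma one_word: "1 = word []"
  by (simp add: single_one[symmetric] zero_list_def del: single_one)

lemma lin_ext_word: "lin_ext pscale f (word w) = f w"
  by (simp add: lin_ext_single[OF vector_space_pscale])

lemma plin_ab_coprod: "plin ab_coprod"
  unfolding ab_coprod_def by (rule plin_lin_ext)

lemma ab_coprod_word:
  "ab_coprod (word w) = (\<Sum>i<length w. Poly_Mapping.single (take i w, drop (Suc i) w) 1)"
  by (simp add: ab_coprod_def lin_ext_word)

text \<open>The convolution product of \<open>f\<close> and \<open>g\<close>, with a letter \<open>b\<close> inserted between the factors. For this
  product \<open>T\<close> is the geometric series \<open>\<kappa> + \<nu> b \<kappa> + \<nu> b \<nu> b \<kappa> + \<dots>\<close>.\<close>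
definition coprod_join :: "('k::field abpoly \<Rightarrow> 'k abpoly) \<Rightarrow> ('k abpoly \<Rightarrow> 'k abpoly) \<Rightarrow> 'k abpoly \<Rightarrow> 'k abpoly" where
  "coprod_join f g u = lin_ext pscale (\<lambda>(v, w). f (word v) * bvar * g (word w)) (ab_coprod u)"

lemma plin_coprod_join: "plin (coprod_join f g)"
  unfolding coprod_join_def by (rule plin_compose[OF plin_lin_ext plin_ab_coprod])

lemma coprod_join_word:
  "coprod_join f g (word w) = (\<Sum>i<length w. f (word (take i w)) * bvar * g (word (drop (Suc i) w)))"
  unfolding coprod_join_def ab_coprod_word
  by (simp add: plin_simps(5)[OF plin_lin_ext] lin_ext_single[OF vector_space_pscale])

text \<open>The coproduct removes either the first letter \<open>x\<close>, leaving \<open>1 \<otimes> u\<close>, or a letter of \<open>u\<close>.\<close>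
lemma coprod_join_letter:
  assumes g: "plin g"
  shows "coprod_join f g (word [x] * u) = f 1 * bvar * g u + coprod_join (\<lambda>v. f (word [x] * v)) g u"
proof (rule plin_eqI[where u = u])
  show "plin (\<lambda>u. coprod_join f g (word [x] * u))"
    by (intro plin_compose[OF plin_coprod_join] plin_intros)
  show "plin (\<lambda>u. f 1 * bvar * g u + coprod_join (\<lambda>v. f (word [x] * v)) g u)"
    by (intro plin_intros g plin_coprod_join)
  show "coprod_join f g (word [x] * word w) = f 1 * bvar * g (word w) + coprod_join (\<lambda>v. f (word [x] * v)) g (word w)" for w
    unfolding word_mult[symmetric] coprod_join_word
    by (simp add: sum.lessThan_Suc_shift one_word del: sum.lessThan_Suc)
qed

lemma avar_word: "avar = word [La]" and bvar_word: "bvar = word [Lb]"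
  by (simp_all add: avar_def bvar_def)

abbreviation cvar :: "'k::field abpoly" where "cvar \<equiv> avar - bvar"

text \<open>As \<open>\<Delta> (a - b) = 0\<close>, the terms in which the first letter is removed cancel.\<close>
lemma coprod_join_cvar:
  assumes f: "plin f" and g: "plin g"
  shows "coprod_join f g (cvar * u) = coprod_join (\<lambda>v. f (cvar * v)) g u"
proof -
  have "coprod_join (\<lambda>v. f (cvar * v)) g u =
    coprod_join (\<lambda>v. f (avar * v)) g u - coprod_join (\<lambda>v. f (bvar * v)) g u"
  proof (rule plin_eqI[where u = u])
    fix w
    show "coprod_join (\<lambda>v. f (cvar * v)) g (word w) =
      coprod_join (\<lambda>v. f (avar * v)) g (word w) - coprod_join (\<lambda>v. f (bvar * v)) g (word w)"
      by (simp add: coprod_join_word left_diff_distrib plin_simps(2)[OF f] sum_subtractf)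
  qed (intro plin_intros plin_coprod_join)+
  then show ?thesis
    unfolding left_diff_distrib plin_simps(2)[OF plin_coprod_join]
    by (simp add: avar_word bvar_word coprod_join_letter[OF g])
qed

lemma coprod_join_left_mult:
  "coprod_join (\<lambda>v. y * f v) g u = y * coprod_join f g u"
  by (rule plin_eqI[where u = u]; (intro plin_intros plin_coprod_join)?)
     (simp add: coprod_join_word sum_distrib_left mult.assoc)

lemma coprod_join_zero_left: "coprod_join (\<lambda>v. 0) g u = 0"
  by (rule plin_eqI[where u = u]; (intro plin_intros plin_coprod_join)?) (simp add: coprod_join_word)

lemma coprod_join_one: "coprod_join f g 1 = 0"
  by (simp add: one_word coprod_join_word)

lemma A_word: "A_map (word w) = (\<Prod>x\<leftarrow>w. case x of La \<Rightarrow> 1 | Lb \<Rightarrow> (0 :: 'k::field))"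
  by (simp add: A_map_def lin_ext_single[OF vector_space_mult])

lemma C_word: "C_map (word w) = 2 * A_map (word w) +
   (\<Sum>i<length w. A_map (word (take i w)) * A_map (word (drop (Suc i) w) :: 'k::field abpoly))"
proof -
  interpret L: Vector_Spaces.linear pscale "(*)"
    "lin_ext (*) (\<lambda>(v, w). A_map (word v) * A_map (word w :: 'k abpoly))"
    by (rule linear_lin_ext[OF vector_space_mult])
  show ?thesis
    by (simp add: C_map_def ab_coprod_word L.sum lin_ext_single[OF vector_space_mult])
qed

lemma plin_kappa: "plin kappa" and plin_nu: "plin nu"
  unfolding kappa_def nu_def by (rule plin_lin_ext)+

lemma kappa_one: "kappa 1 = 1"
  by (simp add: one_word kappa_def lin_ext_word A_word)

lemma nu_one: "nu 1 = pscale 2 1"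
  by (simp add: one_word nu_def lin_ext_word A_word C_word)

lemma kappa_avar: "kappa (avar * u) = cvar * kappa u" and kappa_bvar: "kappa (bvar * u) = 0"
proof -
  show "kappa (avar * u) = cvar * kappa u"
    by (rule plin_eqI[where u = u]; (intro plin_intros plin_compose[OF plin_kappa] plin_kappa)?)
       (simp add: avar_word word_mult[symmetric] kappa_def lin_ext_word A_word pscale_mult_right)
  show "kappa (bvar * u) = 0"
    by (rule plin_eqI[where u = u]; (intro plin_intros plin_compose[OF plin_kappa] plin_kappa)?)
       (simp add: bvar_word word_mult[symmetric] kappa_def lin_ext_word A_word)
qed

text \<open>Removing the first letter contributes \<open>A u\<close> to \<open>C (a u)\<close> and to \<open>C (b u)\<close>. Hence \<open>C (a u) = C u + A u\<close>
  and \<open>C (b u) = A u\<close>.\<close>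
lemma
  fixes u :: "'k::field abpoly"
  shows nu_avar: "nu (avar * u) = cvar * nu u + cvar * kappa u"
    and nu_bvar: "nu (bvar * u) = cvar * kappa u"
proof -
  have A: "A_map (word (La # w)) = (A_map (word w) :: 'k)" "A_map (word (Lb # w)) = (0 :: 'k)" "A_map (word []) = (1::'k)"  for w
    by (simp_all add: A_word)
  have "C_map (word (La # w)) = (C_map (word w) + A_map (word w) :: 'k)"
    "C_map (word (Lb # w)) = (A_map (word w) :: 'k)" for w
    by (simp_all add: C_word sum.lessThan_Suc_shift A del: sum.lessThan_Suc)
  note C = this
  show "nu (avar * u) = cvar * nu u + cvar * kappa u"
    by (rule plin_eqI[where u = u]; (intro plin_intros plin_compose[OF plin_nu] plin_nu plin_kappa)?)
       (simp only: avar_word word_mult[symmetric] nu_def kappa_def lin_ext_word C pscale_mult_right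
          pm.scale_left_distrib length_Cons power_Suc)
  show "nu (bvar * u) = cvar * kappa u"
    by (rule plin_eqI[where u = u]; (intro plin_intros plin_compose[OF plin_nu] plin_nu plin_kappa)?)
       (simp only: bvar_word word_mult[symmetric] nu_def kappa_def lin_ext_word C pscale_mult_right
          length_Cons power_Suc)
qed

lemma kappa_cvar: "kappa (cvar * u) = cvar * kappa u"
  by (simp add: left_diff_distrib plin_simps(2)[OF plin_kappa] kappa_avar kappa_bvar)

lemma nu_cvar: "nu (cvar * u) = cvar * nu u"
proof -
  have "nu (cvar * u) = nu (avar * u) - nu (bvar * u)"
    by (simp add: left_diff_distrib plin_simps(2)[OF plin_nu])
  then show ?thesis by (simp add: nu_avar nu_bvar)
qed

text \<open>The summand of \<open>T\<close> for the coproduct into \<open>k + 1\<close> parts.\<close>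
definition T_part :: "nat \<Rightarrow> 'k::field abpoly \<Rightarrow> 'k abpoly" where
  "T_part k u = lin_ext pscale T_term (ab_coprod_iter k u)"

lemma plin_T_part: "plin (T_part k)"
  unfolding T_part_def by (rule plin_compose[OF plin_lin_ext linear_ab_coprod_iter])

lemma T_part_0: "T_part 0 u = kappa u"
  by (rule plin_eqI[where u = u]; (intro plin_T_part plin_kappa)?) (simp add: T_part_def lin_ext_word)

lemma lin_ext_mult_word:
  "lin_ext pscale f (word [x] * d) = lin_ext pscale (\<lambda>r. f (x # r)) d"
  by (rule plin_eqI[where u = d]; (intro plin_intros plin_compose[OF plin_lin_ext])?)
     (simp add: word_mult[symmetric] lin_ext_word)

text \<open>A rule for maps such as \<open>T_term\<close> and \<open>ab_mon\<close>, where the first entry of a list contributes a factor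
  as soon as another entry follows. The condition on \<open>d\<close> excludes lists with a single entry.\<close>
lemma lin_ext_mult_word_factor:
  fixes f :: "'a list \<Rightarrow> ('b::monoid_add \<Rightarrow>\<^sub>0 'k::field)"
  assumes d: "Poly_Mapping.lookup d [] = 0"
    and f: "\<And>y r. f (x # y # r) = z * f (y # r)"
  shows "lin_ext pscale f (word [x] * d) = z * lin_ext pscale f d"
proof -
  have "lin_ext pscale f (word [x] * d) = lin_ext pscale (\<lambda>r. f (x # r)) d"
    by (rule lin_ext_mult_word)
  also have "\<dots> = (\<Sum>w\<in>Poly_Mapping.keys d. pscale (Poly_Mapping.lookup d w) (z * f w))"
    unfolding lin_ext_def
  proof (rule sum.cong)
    fix w assume "w \<in> Poly_Mapping.keys d"
    then have "w \<noteq> []" using d by (auto simp: in_keys_iff)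
    then show "pscale (Poly_Mapping.lookup d w) (f (x # w)) = pscale (Poly_Mapping.lookup d w) (z * f w)"
      by (cases w) (simp_all add: f)
  qed simp
  also have "\<dots> = z * lin_ext pscale f d"
    by (simp add: lin_ext_def sum_distrib_left pscale_mult_right)
  finally show ?thesis .
qed

lemma T_part_Suc: "T_part (Suc k) = coprod_join nu (T_part k :: 'k::field abpoly \<Rightarrow> _)"
proof -
  have iter: "ab_coprod_iter (Suc k) (word w) =
    (\<Sum>i<length w. word [take i w] * ab_coprod_iter k (word (drop (Suc i) w) :: 'k abpoly))" for k w
    by (simp add: ab_coprod_word plin_simps(5)[OF plin_lin_ext] lin_ext_single[OF vector_space_pscale])
  have Nil: "Poly_Mapping.lookup (ab_coprod_iter k (word w :: 'k abpoly)) [] = 0" for k w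
  proof (cases k)
    case 0
    then show ?thesis by (simp add: lin_ext_word lookup_single)
  next
    case (Suc k)
    then show ?thesis by (simp only: iter lookup_sum lookup_mult_word) simp
  qed
  have head: "lin_ext pscale T_term (word [v] * d) = nu (word v) * bvar * lin_ext pscale T_term d"
    if "Poly_Mapping.lookup d [] = 0" for v and d :: "letter list list \<Rightarrow>\<^sub>0 'k"
    by (rule lin_ext_mult_word_factor[OF that]) simp
  have "T_part (Suc k) (word w) = coprod_join nu (T_part k) (word w :: 'k abpoly)" for w
    unfolding T_part_def iter coprod_join_word plin_simps(5)[OF plin_lin_ext]
    by (simp only: head Nil)
  then show ?thesis
    by (intro linear_eqI[of pscale] plin_T_part plin_coprod_join) auto
qed

lemma T_part_eq_0: "length w < k \<Longrightarrow> T_part k (word w) = 0"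
  by (simp add: T_part_def ab_coprod_iter_eq_0 plin_simps(4)[OF plin_lin_ext])

lemma T_map_word:
  assumes "length w \<le> n"
  shows "T_map (word w :: 'k::field abpoly) = (\<Sum>k\<le>n. T_part k (word w))"
proof -
  have "{k. T_part k (word w :: 'k abpoly) \<noteq> 0} \<subseteq> {..n}"
    using T_part_eq_0[of w, where ?'a = 'k] assms by (force simp: not_less[symmetric])
  then show ?thesis
    unfolding T_map_def T_part_def[symmetric] by (intro Sum_any.expand_superset) auto
qed

lemma plin_T_map: "plin (T_map :: 'k::field abpoly \<Rightarrow> _)"
  unfolding plin_iff
proof (intro conjI allI)
  have fin: "finite {k. T_part k (u :: 'k abpoly) \<noteq> 0}" for u
    unfolding T_part_def by (rule finite_T_terms)
  fix u v :: "'k abpoly" and c :: 'k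
  show "T_map (u + v) = T_map u + T_map v"
    unfolding T_map_def T_part_def[symmetric] plin_simps(1)[OF plin_T_part]
    by (rule Sum_any.distrib) (rule fin)+
  show "T_map (pscale c u) = pscale c (T_map u)"
    unfolding T_map_def T_part_def[symmetric] plin_simps(3)[OF plin_T_part]
    unfolding pscale_conv by (rule Sum_any_right_distrib[symmetric]) (rule fin)
qed

text \<open>Split off the first factor: the term without factor \<open>\<nu>\<close> is \<open>\<kappa> u\<close>, and the other terms start with
  \<open>\<nu>\<close> of the left part of the coproduct.\<close>
lemma T_map_eq: "T_map u = kappa u + coprod_join nu T_map u"
proof (rule plin_eqI[where u = u])
  fix w :: "letter list"
  have "T_map (word w) = T_part 0 (word w) + (\<Sum>k<length w. T_part (Suc k) (word w))"
    by (simp only: T_map_word[OF order.refl] sum.atMost_shift)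
  also have "(\<Sum>k<length w. T_part (Suc k) (word w)) = (\<Sum>i<length w. \<Sum>k<length w.
      nu (word (take i w)) * bvar * T_part k (word (drop (Suc i) w)))"
    unfolding T_part_Suc coprod_join_word by (rule sum.swap)
  also have "\<dots> = coprod_join nu T_map (word w)"
    unfolding coprod_join_word
  proof (rule sum.cong)
    fix i assume "i \<in> {..<length w}"
    \<comment> \<open>The truncation at \<open>length w - 1\<close> is long enough, since \<open>drop (Suc i) w\<close> has fewer letters than \<open>w\<close>.\<close>
    then have "length (drop (Suc i) w) \<le> length w - 1" "{..<length w} = {..length w - 1}" by auto
    then show "(\<Sum>k<length w. nu (word (take i w)) * bvar * T_part k (word (drop (Suc i) w))) =
      nu (word (take i w)) * bvar * T_map (word (drop (Suc i) w))"
      by (simp only: T_map_word sum_distrib_left)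
  qed simp
  finally show "T_map (word w) = kappa (word w) + coprod_join nu T_map (word w)"
    by (simp only: T_part_0)
qed (intro plin_intros plin_T_map plin_kappa plin_coprod_join)+

text \<open>The companion of \<open>T\<close> in the recursion on the first letter. Since \<open>\<nu> (b u) = (a - b) \<kappa> u\<close>, it collects the terms
  of \<open>T (b u)\<close> whose first factor \<open>\<nu>\<close> contains the letter \<open>b\<close>, up to the factor \<open>a - b\<close>.\<close>
definition T_aux :: "'k::field abpoly \<Rightarrow> 'k abpoly" where
  "T_aux = coprod_join kappa T_map"

lemma T_map_one: "T_map 1 = 1"
  by (subst T_map_eq) (simp add: kappa_one coprod_join_one)

lemma T_map_cvar: "T_map (cvar * u) = cvar * T_map u"
  by (subst (1 2) T_map_eq)
     (simp only: kappa_cvar coprod_join_cvar[OF plin_nu plin_T_map] nu_cvar coprod_join_left_mult distrib_left)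

lemma T_map_bvar: "T_map (bvar * u) = pscale 2 (bvar * T_map u) + cvar * T_aux u"
proof -
  have "T_map (bvar * u) = coprod_join nu T_map (bvar * u)"
    by (subst T_map_eq) (simp add: kappa_bvar)
  also have "\<dots> = nu 1 * bvar * T_map u + coprod_join (\<lambda>v. nu (bvar * v)) T_map u"
    using coprod_join_letter[OF plin_T_map, of nu Lb u] by (simp only: bvar_word)
  also have "\<dots> = pscale 2 (bvar * T_map u) + cvar * T_aux u"
    by (simp only: nu_one nu_bvar coprod_join_left_mult T_aux_def pscale_mult_left mult_1_left)
  finally show ?thesis .
qed

lemma T_aux_one: "T_aux 1 = 0"
  by (simp add: T_aux_def coprod_join_one)

lemma T_aux_cvar: "T_aux (cvar * u) = cvar * T_aux u"
  by (simp only: T_aux_def coprod_join_cvar[OF plin_kappa plin_T_map] kappa_cvar coprod_join_left_mult)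

lemma T_aux_bvar: "T_aux (bvar * u) = bvar * T_map u"
proof -
  have "T_aux (bvar * u) = kappa 1 * bvar * T_map u + coprod_join (\<lambda>v. kappa (bvar * v)) T_map u"
    unfolding T_aux_def using coprod_join_letter[OF plin_T_map, of kappa Lb u] by (simp only: bvar_word)
  also have "\<dots> = bvar * T_map u"
    by (simp only: kappa_one kappa_bvar coprod_join_zero_left mult_1_left add_0_right)
  finally show ?thesis .
qed

lemma plin_H_star: "plin H_star"
  unfolding H_star_def by (rule plin_lin_ext)

lemma H_star_word: "H_star (word w) = (if w = [] then 0 else word (butlast w))"
  by (simp add: H_star_def lin_ext_word)

text \<open>\<open>H_star\<close> removes the last letter, so it commutes with multiplication from the left except where the
  right factor has no letter to remove.\<close>
lemma H_star_mult:
  fixes y v :: "'k::field abpoly"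
  assumes "Poly_Mapping.lookup v [] = 0"
  shows "H_star (y * v) = y * H_star v"
proof -
  \<comment> \<open>With the correction for the constant term of \<open>v\<close> the identity is linear in \<open>v\<close>.\<close>
  have "H_star (y * v) = y * H_star v + pscale (Poly_Mapping.lookup v []) (H_star y)"
  proof (rule plin_eqI[where u = v])
    fix w
    show "H_star (y * word w) = y * H_star (word w) + pscale (Poly_Mapping.lookup (word w) []) (H_star y)"
    proof (cases "w = []")
      case True
      have "H_star (1 :: 'k abpoly) = 0" unfolding one_word H_star_word by simp
      then show ?thesis unfolding True one_word[symmetric] by (simp add: lookup_one_list)
    next
      case False
      have "H_star (y * word w) = y * word (butlast w)"
      proof (rule plin_eqI[where u = y])
        show "plin (\<lambda>y. H_star (y * word w))"
          by (intro plin_compose[OF plin_H_star] plin_intros)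
        show "plin (\<lambda>y. y * word (butlast w))" by (intro plin_intros)
        show "H_star (word w' * word w) = word w' * word (butlast w)" for w'
          using False by (simp add: mult_single plus_list_def H_star_word butlast_append)
      qed
      then show ?thesis using False by (simp add: H_star_word lookup_single)
    qed
    show "plin (\<lambda>v. H_star (y * v))" by (intro plin_compose[OF plin_H_star] plin_intros)
    show "plin (\<lambda>v. y * H_star v + pscale (Poly_Mapping.lookup v []) (H_star y))"
      using plin_mult_left[OF plin_H_star, of y]
      by (simp add: plin_iff lookup_add pm.scale_left_distrib pm.scale_right_distrib)
  qed
  then show ?thesis using assms by simp
qed

lemma avar_split: "avar * u = cvar * u + bvar * u"
  by (simp add: left_diff_distrib)

lemma lookup_letter_mult_Nil:
  "Poly_Mapping.lookup (bvar * u) [] = 0" "Poly_Mapping.lookup (cvar * u) [] = 0"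
  by (simp_all add: avar_word bvar_word left_diff_distrib lookup_minus lookup_mult_word)

lemma plin_T_aux: "plin T_aux"
  unfolding T_aux_def by (rule plin_coprod_join)

lemma lookup_T_letter_Nil:
  "Poly_Mapping.lookup (T_map (word [x] * u)) [] = 0"
  "Poly_Mapping.lookup (T_aux (word [x] * u)) [] = 0"
proof -
  have "Poly_Mapping.lookup (T_map (cvar * u)) [] = 0" "Poly_Mapping.lookup (T_map (bvar * u)) [] = 0"
    "Poly_Mapping.lookup (T_aux (cvar * u)) [] = 0" "Poly_Mapping.lookup (T_aux (bvar * u)) [] = 0"
    by (simp_all only: T_map_cvar T_map_bvar T_aux_cvar T_aux_bvar lookup_add lookup_pscale
        lookup_letter_mult_Nil) simp_all
  note parts = this
  have "word [x] * u = cvar * u + bvar * u \<or> word [x] * u = bvar * u"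
    by (cases x) (simp_all add: avar_word[symmetric] bvar_word[symmetric] avar_split[symmetric])
  then show "Poly_Mapping.lookup (T_map (word [x] * u)) [] = 0"
    "Poly_Mapping.lookup (T_aux (word [x] * u)) [] = 0"
    by (elim disjE; simp only: plin_simps(1)[OF plin_T_map] plin_simps(1)[OF plin_T_aux] lookup_add parts
        add_0_left)+
qed

text \<open>The factor \<open>a\<close> in the definition of \<open>U\<close> ensures that \<open>T\<close> is applied to a polynomial without constant
  term; its values then have no constant term either.\<close>
lemma H_star_mult_T:
  fixes u y :: "'k::field abpoly"
  shows "H_star (y * T_map (u * avar)) = y * H_star (T_map (u * avar))"
  "H_star (y * T_aux (u * avar)) = y * H_star (T_aux (u * avar))"
proof -
  have nonempty: "\<exists>x v. word w * avar = word [x] * (v :: 'k abpoly)" for w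
  proof (cases w)
    case Nil
    then have "word w * avar = word [La] * (1 :: 'k abpoly)" by (simp add: avar_word one_word[symmetric] del: single_one)
    then show ?thesis by blast
  next
    case (Cons x w')
    then have "word w * avar = word [x] * (word w' * avar :: 'k abpoly)" by (simp only: word_mult[of x w'] mult.assoc)
    then show ?thesis by blast
  qed
  show "H_star (y * T_map (u * avar)) = y * H_star (T_map (u * avar))"
  proof (rule plin_eqI[where u = u])
    show "plin (\<lambda>u. H_star (y * T_map (u * avar)))" "plin (\<lambda>u. y * H_star (T_map (u * avar)))"
      by (intro plin_compose[OF plin_H_star] plin_compose[OF plin_T_map] plin_intros)+
    fix w
    obtain x v where "word w * avar = word [x] * (v :: 'k abpoly)" using nonempty by blast
    then show "H_star (y * T_map (word w * avar)) = y * H_star (T_map (word w * avar))"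
      by (simp only: H_star_mult lookup_T_letter_Nil)
  qed
  show "H_star (y * T_aux (u * avar)) = y * H_star (T_aux (u * avar))"
  proof (rule plin_eqI[where u = u])
    show "plin (\<lambda>u. H_star (y * T_aux (u * avar)))" "plin (\<lambda>u. y * H_star (T_aux (u * avar)))"
      by (intro plin_compose[OF plin_H_star] plin_compose[OF plin_T_aux] plin_intros)+
    fix w
    obtain x v where "word w * avar = word [x] * (v :: 'k abpoly)" using nonempty by blast
    then show "H_star (y * T_aux (word w * avar)) = y * H_star (T_aux (word w * avar))"
      by (simp only: H_star_mult lookup_T_letter_Nil)
  qed
qed

definition U_aux :: "'k::field abpoly \<Rightarrow> 'k abpoly" where
  "U_aux u = H_star (T_aux (u * avar))"

lemma plin_U_ab: "plin U_ab"
  unfolding U_ab_def[abs_def] by (intro plin_compose[OF plin_H_star] plin_compose[OF plin_T_map] plin_intros)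

lemma U_one: "U_ab 1 = pscale 2 1" and U_aux_one: "U_aux 1 = 1"
proof -
  have H: "H_star avar = 1" "H_star bvar = 1"
    by (simp_all add: avar_word bvar_word H_star_word one_word)
  have a: "1 * avar = cvar * 1 + bvar * 1" by simp
  show "U_ab 1 = pscale 2 1"
    unfolding U_ab_def a plin_simps(1)[OF plin_T_map] T_map_cvar T_map_bvar T_map_one T_aux_one
    by (simp add: plin_simps[OF plin_H_star] H)
  show "U_aux 1 = 1"
    unfolding U_aux_def a plin_simps(1)[OF plin_T_aux] T_aux_cvar T_aux_bvar T_map_one T_aux_one
    by (simp add: plin_simps[OF plin_H_star] H)
qed

text \<open>The recursions for \<open>T\<close> and its companion involve multiplication from the left only, so they are
  not affected by the factor \<open>a\<close> on the right and commute with \<open>H_star\<close>.\<close>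
lemma U_cvar: "U_ab (cvar * u) = cvar * U_ab u"
  and U_bvar: "U_ab (bvar * u) = pscale 2 (bvar * U_ab u) + cvar * U_aux u"
  and U_aux_cvar: "U_aux (cvar * u) = cvar * U_aux u"
  and U_aux_bvar: "U_aux (bvar * u) = bvar * U_ab u"
  unfolding U_ab_def U_aux_def
  by (simp_all only: mult.assoc T_map_cvar T_map_bvar T_aux_cvar T_aux_bvar
      plin_simps[OF plin_H_star] H_star_mult_T)

lemma U_cvar_power: "U_ab (cvar ^ n * u) = cvar ^ n * U_ab u"
  and U_aux_cvar_power: "U_aux (cvar ^ n * u) = cvar ^ n * U_aux u"
  by (induction n) (simp_all only: power_0 power_Suc mult_1_left mult.assoc U_cvar U_aux_cvar)

text \<open>The first \<open>b\<close> of \<open>ab_mon (x # y # r)\<close> either survives with the factor \<open>2\<close>, and \<open>x\<close> is a block of its own,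
  or it turns into \<open>a - b\<close>. In the second case \<open>U_aux\<close> continues to the next \<open>b\<close>, which survives with
  factor \<open>1\<close> and ends the block \<open>x + y\<close>.\<close>
lemma U_ab_mon:
  assumes "p \<in> compositions" "p \<noteq> []"
  shows "U_ab (ab_mon p) = lin_ext pscale ab_mon (merged p :: _ \<Rightarrow>\<^sub>0 'k::field)"
  using assms
proof (induction p rule: merged.induct)
  case (2 x)
  have "U_ab (ab_mon [x]) = cvar ^ (x - 1) * (U_ab 1 :: 'k abpoly)"
    using U_cvar_power[of "x - 1" 1] by simp
  then show ?case
    by (simp only: U_one pscale_mult_right mult_1_right merged.simps plin_simps(3)[OF plin_lin_ext] lin_ext_word)
      simp
next
  case (3 x y r)
  have xy: "x \<ge> 1" "y \<ge> 1" and r: "r \<in> compositions" using "3.prems" by (auto simp: compositions_def)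
  have IH: "U_ab (ab_mon (y # r)) = lin_ext pscale ab_mon (merged (y # r) :: _ \<Rightarrow>\<^sub>0 'k)"
    by (rule "3.IH"(1)) (use "3.prems" in \<open>auto simp: compositions_def\<close>)
  have pow: "cvar ^ (x - 1) * (cvar * cvar ^ (y - 1)) = (cvar ^ (x + y - 1) :: 'k abpoly)"
    using xy by (simp only: power_Suc[symmetric] power_add[symmetric]) (rule arg_cong[of _ _ "power cvar"], simp)
  have first: "lin_ext pscale ab_mon (word [x] * merged (y # r)) = cvar ^ (x - 1) * bvar * (U_ab (ab_mon (y # r)) :: 'k abpoly)"
    unfolding IH by (rule lin_ext_mult_word_factor) (simp_all add: lookup_merged_Nil)
  \<comment> \<open>If \<open>r\<close> is empty there is no further \<open>b\<close>, and \<open>U_aux_one\<close> ends the block.\<close>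
  have second: "lin_ext pscale ab_mon (word [x + y] * merged r) = cvar ^ (x - 1) * (cvar * U_aux (ab_mon (y # r)) :: 'k abpoly)"
  proof (cases r)
    case Nil
    have "U_aux (ab_mon [y]) = (cvar ^ (y - 1) :: 'k abpoly)"
      using U_aux_cvar_power[of "y - 1" 1] by (simp add: U_aux_one)
    then show ?thesis using pow by (simp add: Nil merged.simps lin_ext_word)
  next
    case (Cons z r')
    have "lin_ext pscale ab_mon (word [x + y] * merged r) = cvar ^ (x + y - 1) * bvar * lin_ext pscale ab_mon (merged r :: _ \<Rightarrow>\<^sub>0 'k)"
      by (rule lin_ext_mult_word_factor) (simp_all add: lookup_merged_Nil Cons)
    also have "lin_ext pscale ab_mon (merged r :: _ \<Rightarrow>\<^sub>0 'k) = U_ab (ab_mon r)"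
      by (rule "3.IH"(2)[symmetric]) (use r Cons in auto)
    also have "cvar ^ (x + y - 1) * bvar * (U_ab (ab_mon r) :: 'k abpoly) = cvar ^ (x - 1) * (cvar * U_aux (ab_mon (y # r)))"
      by (simp only: Cons ab_mon.simps mult.assoc U_aux_cvar_power U_aux_bvar pow[symmetric])
    finally show ?thesis .
  qed
  have "U_ab (ab_mon (x # y # r)) =
    pscale 2 (cvar ^ (x - 1) * bvar * U_ab (ab_mon (y # r))) + cvar ^ (x - 1) * (cvar * U_aux (ab_mon (y # r)) :: 'k abpoly)"
    by (simp only: ab_mon.simps mult.assoc U_cvar_power U_bvar distrib_left pscale_mult_right)
  then show ?case
    by (simp only: merged.simps plin_simps[OF plin_lin_ext] first second)
qed simp

section \<open>The Tchebyshev transform doubles the variables\<close>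

lemma linear_doubling: "Vector_Spaces.linear mscale mscale (doubling :: 'k::field mps \<Rightarrow> _)"
  by (simp add: Vector_Spaces.linear_iff vector_space_mscale doubling_add doubling_mscale)

lemma gamma_lin_ext_ab_mon:
  fixes d :: "nat list \<Rightarrow>\<^sub>0 'k::field"
  assumes "Poly_Mapping.keys d \<subseteq> compositions" "Poly_Mapping.lookup d [] = 0"
  shows "gamma (lin_ext pscale ab_mon d) = M_comb d"
proof -
  interpret G: Vector_Spaces.linear pscale mscale "gamma :: 'k abpoly \<Rightarrow> _" by (rule linear_gamma)
  have "gamma (ab_mon p) = (M p :: 'k mps)" if "p \<in> Poly_Mapping.keys d" for p
    using assms that by (intro gamma_ab_mon) (auto simp: in_keys_iff)
  then show ?thesis
    by (simp add: lin_ext_def M_comb_def G.sum G.scale)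
qed

lemma doubling_gamma: "doubling (gamma u) = gamma (U_ab (u :: 'k::field abpoly))"
proof -
  interpret G: Vector_Spaces.linear pscale mscale "gamma :: 'k abpoly \<Rightarrow> _" by (rule linear_gamma)
  let ?s = "subst sub_cb :: 'k abpoly \<Rightarrow> _"
  have s: "plin ?s" by (rule linear_subst)
  have "(\<lambda>v. doubling (gamma (?s v))) = (\<lambda>v. gamma (U_ab (?s v)))"
  proof (rule linear_eqI)
    show "Vector_Spaces.linear pscale mscale (\<lambda>v. doubling (gamma (?s v)))"
      "Vector_Spaces.linear pscale mscale (\<lambda>v. gamma (U_ab (?s v)))"
      by (simp_all add: Vector_Spaces.linear_iff vector_space_pscale vector_space_mscale plin_simps[OF s]
          plin_simps[OF plin_U_ab] G.add G.scale doubling_add doubling_mscale)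
    fix w
    let ?p = "comp_of w"
    have "gamma (U_ab (ab_mon ?p)) = M_comb (merged ?p :: _ \<Rightarrow>\<^sub>0 'k)"
      by (simp add: U_ab_mon comp_of_comp comp_of_ne gamma_lin_ext_ab_mon keys_merged lookup_merged_Nil)
    then show "doubling (gamma (?s (word w))) = gamma (U_ab (?s (word w)))"
      by (simp add: ab_mon_comp_of[symmetric] gamma_ab_mon comp_of_comp comp_of_ne doubling_M)
  qed
  then have "doubling (gamma (?s (subst sub_ab u))) = gamma (U_ab (?s (subst sub_ab u)))" by (rule fun_cong)
  then show ?thesis by (simp only: sub_inverse)
qed

lemma M_Nil: "M [] = 1"
  by (rule mps_eqI) (auto simp: M_def monom_Nil)

lemma one_in_QSym: "1 \<in> QSym"
  using M_in_QSym[of "[]"] by (simp add: M_Nil compositions_def)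

text \<open>Outside \<open>QSym\<close> the values of \<open>inv gamma\<close>, and with them those of \<open>U_QSym\<close>, are unspecified.\<close>
lemma U_QSym_eq_doubling:
  assumes f: "f \<in> QSym"
  shows "U_QSym f = doubling f"
proof -
  let ?g = "f - mscale (qcounit f) 1"
  have "?g \<in> QSym"
    using f one_in_QSym by (intro mps.subspace_diff mps.subspace_scale subspace_QSym)
  moreover have "qcounit ?g = 0" by (simp add: qcounit_def)
  ultimately have "?g \<in> range gamma" by (simp add: range_gamma)
  then have "gamma (U_ab (inv gamma ?g)) = doubling ?g"
    by (simp add: doubling_gamma[symmetric] f_inv_into_f)
  then have "U_QSym f = doubling (mscale (qcounit f) 1) + doubling ?g"
    by (simp add: U_QSym_def doubling_mscale doubling_one)
  also have "\<dots> = doubling f" by (simp add: doubling_add[symmetric])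
  finally show ?thesis .
qed

text \<open>The range of \<open>gamma\<close> lies in \<open>QSym\<close>, so this follows from the expression of doubling by the
  Tchebyshev transform.\<close>
lemma doubling_in_QSym:
  assumes "f \<in> QSym"
  shows "doubling f \<in> QSym"
proof -
  have "gamma u \<in> QSym" for u :: "'a abpoly"
    using range_gamma by blast
  then have "U_QSym f \<in> QSym"
    unfolding U_QSym_def using one_in_QSym by (intro mps.subspace_add mps.subspace_scale subspace_QSym)
  then show ?thesis by (simp add: U_QSym_eq_doubling assms)
qed

section \<open>Compatibility with the coproduct\<close>

lemma lookup_lin_ext:
  "Poly_Mapping.lookup (lin_ext pscale f c) q =
    (\<Sum>p\<in>Poly_Mapping.keys c. Poly_Mapping.lookup c p * Poly_Mapping.lookup (f p) q)"
  by (simp add: lin_ext_def lookup_sum)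

lemma M_comb_in_QSym: "Poly_Mapping.keys c \<subseteq> compositions \<Longrightarrow> M_comb c \<in> QSym"
  unfolding M_comb_def lin_ext_def
  by (intro mps.subspace_sum mps.subspace_scale subspace_QSym M_in_QSym) auto

lemma M_coords_M_comb:
  assumes "Poly_Mapping.keys c \<subseteq> compositions"
  shows "M_coords (M_comb c) = c"
  unfolding M_coords_def
  by (rule the1_equality[OF M_coords_ex1[OF M_comb_in_QSym[OF assms]]]) (simp add: assms M_comb_def)

lemma compositions_take_drop:
  assumes "p \<in> compositions"
  shows "take i p \<in> compositions" "drop i p \<in> compositions"
  using assms by (auto simp: compositions_def dest: in_set_takeD in_set_dropD)

lemma QSym_cases:
  assumes "f \<in> QSym"
  obtains c where "Poly_Mapping.keys c \<subseteq> compositions" "f = M_comb c"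
  by (rule that[OF keys_M_coords[OF assms]]) (simp add: M_comb_def lin_ext_M_coords[OF assms])

text \<open>A way to cut \<open>p\<close> into blocks with sums \<open>q @ q'\<close> is a cut of \<open>p\<close> in two, with a way to cut the first
  piece into blocks with sums \<open>q\<close> and the second one into blocks with sums \<open>q'\<close>.\<close>
lemma lookup_merged_append:
  "Poly_Mapping.lookup (merged p :: nat list \<Rightarrow>\<^sub>0 'k::field) (q @ q') =
    (\<Sum>i\<le>length p. Poly_Mapping.lookup (merged (take i p)) q * Poly_Mapping.lookup (merged (drop i p)) q')"
proof (induction q arbitrary: p)
  case Nil
  have "(\<Sum>i\<le>length p. Poly_Mapping.lookup (merged (take i p)) [] * Poly_Mapping.lookup (merged (drop i p)) q') =
    (\<Sum>i\<le>length p. if i = 0 then Poly_Mapping.lookup (merged p :: nat list \<Rightarrow>\<^sub>0 'k) q' else 0)"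
    by (rule sum.cong) (auto simp: lookup_merged_Nil)
  then show ?case by simp
next
  case (Cons e q)
  let ?l = "\<lambda>p. Poly_Mapping.lookup (merged p :: nat list \<Rightarrow>\<^sub>0 'k)"
  show ?case
  proof (cases p rule: merged.cases)
    case 1
    then show ?thesis by (simp add: lookup_merged_Cons)
  next
    case (2 x)
    then show ?thesis
      using Cons.IH[of "[]"] by (simp add: lookup_merged_Cons)
  next
    case (3 x y r)
    have "(\<Sum>i\<le>length p. ?l (take i p) (e # q) * ?l (drop i p) q') =
      (\<Sum>i\<le>length (y # r). ?l (x # take i (y # r)) (e # q) * ?l (drop i (y # r)) q')"
      by (simp add: 3 sum.atMost_Suc_shift lookup_merged_Cons del: sum.atMost_Suc)
    also have "\<dots> = (\<Sum>i\<le>length (y # r). (if x = e then 2 * (?l (take i (y # r)) q * ?l (drop i (y # r)) q') else 0) +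
       (case take i (y # r) of [] \<Rightarrow> 0 | y # s \<Rightarrow> if x + y = e then ?l s q * ?l (drop i (y # r)) q' else 0))"
    proof (rule sum.cong)
      fix i assume "i \<in> {..length (y # r)}"
      show "?l (x # take i (y # r)) (e # q) * ?l (drop i (y # r)) q' =
        (if x = e then 2 * (?l (take i (y # r)) q * ?l (drop i (y # r)) q') else 0) +
        (case take i (y # r) of [] \<Rightarrow> 0 | y # s \<Rightarrow> if x + y = e then ?l s q * ?l (drop i (y # r)) q' else 0)"
        by (cases i) (simp_all add: lookup_merged_Cons algebra_simps)
    qed simp
    also have "\<dots> = (if x = e then 2 * (\<Sum>i\<le>length (y # r). ?l (take i (y # r)) q * ?l (drop i (y # r)) q') else 0) +
       (\<Sum>i\<le>length (y # r). case take i (y # r) of [] \<Rightarrow> 0 | y # s \<Rightarrow> if x + y = e then ?l s q * ?l (drop i (y # r)) q' else 0)"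
      by (simp add: sum.distrib sum_distrib_left del: take_Cons drop_Cons)
    also have "(\<Sum>i\<le>length (y # r). case take i (y # r) of [] \<Rightarrow> 0 | y # s \<Rightarrow> if x + y = e then ?l s q * ?l (drop i (y # r)) q' else 0) =
      (if x + y = e then (\<Sum>i\<le>length r. ?l (take i r) q * ?l (drop i r) q') else 0)"
      by (simp add: sum.atMost_Suc_shift del: sum.atMost_Suc)
    also have "(if x = e then 2 * (\<Sum>i\<le>length (y # r). ?l (take i (y # r)) q * ?l (drop i (y # r)) q') else 0) + \<dots> = ?l p (e # q @ q')"
      unfolding Cons.IH[symmetric] by (simp add: 3 lookup_merged_Cons)
    finally show ?thesis by simp
  qed
qed

lemma qcoprod_M_comb:
  "Poly_Mapping.keys c \<subseteq> compositions \<Longrightarrow>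
    qcoprod (M_comb c) = lin_ext pscale (\<lambda>p. \<Sum>i\<le>length p. Poly_Mapping.single (take i p, drop i p) 1) c"
  by (simp add: qcoprod_def M_coords_M_comb)

text \<open>Deconcatenation is dual to concatenation.\<close>
lemma lookup_qcoprod:
  assumes "Poly_Mapping.keys c \<subseteq> compositions"
  shows "Poly_Mapping.lookup (qcoprod (M_comb c)) (q, q') = (Poly_Mapping.lookup c (q @ q') :: 'k::field)"
proof -
  have "Poly_Mapping.lookup (\<Sum>i\<le>length p. Poly_Mapping.single (take i p, drop i p) (1 :: 'k)) (q, q') =
    (if p = q @ q' then 1 else 0)" for p
  proof -
    have "Poly_Mapping.lookup (\<Sum>i\<le>length p. Poly_Mapping.single (take i p, drop i p) (1 :: 'k)) (q, q') =
      (\<Sum>i\<le>length p. if i = length q then (if p = q @ q' then 1 else 0) else 0)"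
    proof (unfold lookup_sum, rule sum.cong)
      fix i assume "i \<in> {..length p}"
      then have "(take i p, drop i p) = (q, q') \<longleftrightarrow> i = length q \<and> p = q @ q'"
        by (metis append_eq_conv_conj append_take_drop_id atMost_iff length_take min.absorb2 prod.inject)
      then show "Poly_Mapping.lookup (Poly_Mapping.single (take i p, drop i p) (1 :: 'k)) (q, q') =
        (if i = length q then if p = q @ q' then 1 else 0 else 0)"
        by (simp only: lookup_single when_def) simp
    qed simp
    then show ?thesis by auto
  qed
  then have "Poly_Mapping.lookup (qcoprod (M_comb c)) (q, q') =
    (\<Sum>p\<in>Poly_Mapping.keys c. if p = q @ q' then Poly_Mapping.lookup c p else 0)"
    unfolding qcoprod_M_comb[OF assms] lookup_lin_ext by (intro sum.cong) auto
  then show ?thesis by (simp add: in_keys_iff)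
qed

lemma lookup_qtensor:
  assumes "Poly_Mapping.keys c \<subseteq> compositions" "Poly_Mapping.keys d \<subseteq> compositions"
  shows "Poly_Mapping.lookup (qtensor (M_comb c) (M_comb d)) (q, q') =
    (Poly_Mapping.lookup c q * Poly_Mapping.lookup d q' :: 'k::field)"
proof -
  have "(\<Sum>r\<in>Poly_Mapping.keys d. Poly_Mapping.lookup d r * Poly_Mapping.lookup (Poly_Mapping.single (p, r) 1) (q, q')) =
    (\<Sum>r\<in>Poly_Mapping.keys d. if r = q' then (if p = q then Poly_Mapping.lookup d q' else 0) else 0)" for p
    by (rule sum.cong) (auto simp: lookup_single when_def)
  also have "\<dots> p = (if p = q then Poly_Mapping.lookup d q' else 0)" for p
    by (simp add: in_keys_iff)
  finally have inner: "Poly_Mapping.lookup (lin_ext pscale (\<lambda>r. Poly_Mapping.single (p, r) 1) d) (q, q') =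
    (if p = q then Poly_Mapping.lookup d q' else 0)" for p
    unfolding lookup_lin_ext .
  have "Poly_Mapping.lookup (qtensor (M_comb c) (M_comb d)) (q, q') =
    (\<Sum>p\<in>Poly_Mapping.keys c. if p = q then Poly_Mapping.lookup c q * Poly_Mapping.lookup d q' else 0)"
    unfolding qtensor_def M_coords_M_comb[OF assms(1)] M_coords_M_comb[OF assms(2)] lookup_lin_ext[of _ c] inner
    by (rule sum.cong) auto
  then show ?thesis by (simp add: in_keys_iff)
qed

lemma doubling_M_comb:
  fixes c :: "nat list \<Rightarrow>\<^sub>0 'k::field"
  assumes c: "Poly_Mapping.keys c \<subseteq> compositions"
  shows "doubling (M_comb c) = M_comb (lin_ext pscale merged c)"
proof -
  interpret D: Vector_Spaces.linear mscale mscale "doubling :: 'k mps \<Rightarrow> _" by (rule linear_doubling)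
  interpret L: Vector_Spaces.linear pscale mscale "M_comb :: _ \<Rightarrow> 'k mps" by (rule linear_M_comb)
  have "doubling (M_comb c) = (\<Sum>p\<in>Poly_Mapping.keys c. mscale (Poly_Mapping.lookup c p) (doubling (M p)))"
    by (simp add: M_comb_def lin_ext_def D.sum D.scale)
  also have "\<dots> = (\<Sum>p\<in>Poly_Mapping.keys c. mscale (Poly_Mapping.lookup c p) (M_comb (merged p)))"
    using c by (intro sum.cong) (auto simp: doubling_M)
  also have "\<dots> = M_comb (lin_ext pscale merged c)"
    by (simp add: lin_ext_def L.sum L.scale)
  finally show ?thesis .
qed

lemma keys_lin_ext_merged:
  assumes "Poly_Mapping.keys c \<subseteq> compositions"
  shows "Poly_Mapping.keys (lin_ext pscale merged c :: nat list \<Rightarrow>\<^sub>0 'k::field) \<subseteq> compositions"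
proof
  fix q assume "q \<in> Poly_Mapping.keys (lin_ext pscale merged c :: nat list \<Rightarrow>\<^sub>0 'k)"
  then have "(\<Sum>p\<in>Poly_Mapping.keys c. Poly_Mapping.lookup c p * Poly_Mapping.lookup (merged p :: _ \<Rightarrow>\<^sub>0 'k) q) \<noteq> 0"
    by (simp add: in_keys_iff lookup_lin_ext)
  then obtain p where "p \<in> Poly_Mapping.keys c" "Poly_Mapping.lookup c p * Poly_Mapping.lookup (merged p :: _ \<Rightarrow>\<^sub>0 'k) q \<noteq> 0"
    by (rule sum.not_neutral_contains_not_neutral)
  then have "p \<in> compositions" "q \<in> Poly_Mapping.keys (merged p :: _ \<Rightarrow>\<^sub>0 'k)"
    using assms by (auto simp: in_keys_iff)
  then show "q \<in> compositions" using keys_merged by blast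
qed

lemma plin_qtensor_map: "plin (qtensor_map F G)"
  unfolding qtensor_map_def by (rule plin_lin_ext)

lemma qtensor_map_qcoprod:
  assumes "Poly_Mapping.keys c \<subseteq> compositions"
  shows "qtensor_map F G (qcoprod (M_comb c)) =
    lin_ext pscale (\<lambda>p. \<Sum>i\<le>length p. qtensor (F (M (take i p))) (G (M (drop i p)))) (c :: _ \<Rightarrow>\<^sub>0 'k::field)"
  unfolding qcoprod_M_comb[OF assms] qtensor_map_def
  by (rule plin_eqI[where u = c], rule plin_compose[OF plin_lin_ext plin_lin_ext], rule plin_lin_ext)
     (simp add: lin_ext_word plin_simps(5)[OF plin_lin_ext] lin_ext_single[OF vector_space_pscale])

lemma doubling_qcoprod:
  assumes "f \<in> QSym"
  shows "qcoprod (doubling f) = qtensor_map doubling doubling (qcoprod (f :: 'k::field mps))"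
proof (rule poly_mapping_eqI)
  fix x :: "nat list \<times> nat list"
  obtain q q' where x: "x = (q, q')" by force
  obtain c where c: "Poly_Mapping.keys c \<subseteq> compositions" "f = M_comb c"
    using QSym_cases[OF assms] .
  have tensor: "Poly_Mapping.lookup (qtensor (doubling (M (take i p))) (doubling (M (drop i p)))) (q, q') =
     (Poly_Mapping.lookup (merged (take i p)) q * Poly_Mapping.lookup (merged (drop i p)) q' :: 'k)"
    if "p \<in> compositions" for p i
    using compositions_take_drop[OF that] by (simp add: doubling_M lookup_qtensor keys_merged)
  have "Poly_Mapping.lookup (qcoprod (doubling f)) x =
    (\<Sum>p\<in>Poly_Mapping.keys c. Poly_Mapping.lookup c p * Poly_Mapping.lookup (merged p) (q @ q'))"
    unfolding x c(2) doubling_M_comb[OF c(1)] lookup_qcoprod[OF keys_lin_ext_merged[OF c(1)]] lookup_lin_ext ..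
  also have "\<dots> = Poly_Mapping.lookup (qtensor_map doubling doubling (qcoprod f)) x"
    unfolding x c(2) qtensor_map_qcoprod[OF c(1)] lookup_lin_ext lookup_sum lookup_merged_append
    by (rule sum.cong) (use c(1) in \<open>auto simp: tensor\<close>)
  finally show "Poly_Mapping.lookup (qcoprod (doubling f)) x =
    Poly_Mapping.lookup (qtensor_map doubling doubling (qcoprod f)) x" .
qed

section \<open>Compatibility with the antipode\<close>

lemma mscale_mult_left: "mscale a f * g = mscale a (f * g :: 'k::field mps)"
  and mscale_mult_right: "f * mscale a g = mscale a (f * g :: 'k::field mps)"
  by (rule mps_eqI, simp add: times_mps_def sum_distrib_left case_prod_beta mult_ac)+

lemma linear_qmult: "Vector_Spaces.linear pscale mscale qmult"
  unfolding qmult_def by (rule linear_lin_ext[OF vector_space_mscale])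

lemma qsym_linear_M_comb:
  fixes F :: "'k::field mps \<Rightarrow> 'k mps"
  assumes F: "qsym_linear F" and c: "Poly_Mapping.keys c \<subseteq> compositions"
  shows "F (M_comb c) = (\<Sum>p\<in>Poly_Mapping.keys c. mscale (Poly_Mapping.lookup c p) (F (M p)))"
proof -
  have zero: "F 0 = 0"
    using F mps.subspace_0[OF subspace_QSym] unfolding qsym_linear_def by (metis mps.scale_zero_left)
  have "(\<Sum>p\<in>A. mscale (a p) (M p) :: 'k mps) \<in> QSym \<and> F (\<Sum>p\<in>A. mscale (a p) (M p)) = (\<Sum>p\<in>A. mscale (a p) (F (M p)))"
    if "finite A" "A \<subseteq> compositions" for A a
    using that
  proof (induction A rule: finite_induct)
    case (insert p A)
    then have Mp: "M p \<in> (QSym :: 'k mps set)" by (simp add: M_in_QSym)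
    moreover have "mscale (a p) (M p) \<in> QSym"
      by (rule mps.subspace_scale[OF subspace_QSym Mp])
    ultimately show ?case
      using insert F by (simp add: qsym_linear_def mps.subspace_add[OF subspace_QSym])
  qed (simp add: zero mps.subspace_0[OF subspace_QSym])
  then show ?thesis using c by (simp add: M_comb_def lin_ext_def)
qed

lemma qmult_qtensor:
  assumes f: "f \<in> QSym" and g: "g \<in> QSym"
  shows "qmult (qtensor f g) = f * (g :: 'k::field mps)"
proof -
  interpret Q: Vector_Spaces.linear pscale mscale "qmult :: _ \<Rightarrow> 'k mps" by (rule linear_qmult)
  have single: "qmult (Poly_Mapping.single (p, q) 1) = M p * (M q :: 'k mps)" for p q
    by (simp add: qmult_def lin_ext_single[OF vector_space_mscale])
  have "f * g = lin_ext mscale M (M_coords f) * lin_ext mscale M (M_coords g)"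
    by (simp only: lin_ext_M_coords f g)
  also have "\<dots> = qmult (qtensor f g)"
    by (simp add: qtensor_def lin_ext_def Q.sum Q.scale single sum_product mscale_mult_left
        mscale_mult_right mps.scale_sum_right mult.commute)
  finally show ?thesis by simp
qed

lemma qmult_qtensor_map_qtensor:
  assumes F: "qsym_linear F" and G: "qsym_linear G" and f: "f \<in> QSym" and g: "g \<in> QSym"
  shows "qmult (qtensor_map F G (qtensor f g)) = F f * (G g :: 'k::field mps)"
proof -
  interpret Q: Vector_Spaces.linear pscale mscale "qmult :: _ \<Rightarrow> 'k mps" by (rule linear_qmult)
  obtain c where c: "Poly_Mapping.keys c \<subseteq> compositions" "f = M_comb c" using QSym_cases[OF f] .
  obtain d where d: "Poly_Mapping.keys d \<subseteq> compositions" "g = M_comb d" using QSym_cases[OF g] .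
  have basis: "qmult (qtensor (F (M p)) (G (M q))) = F (M p) * (G (M q))"
    if "p \<in> Poly_Mapping.keys c" "q \<in> Poly_Mapping.keys d" for p q
    using that c(1) d(1) F G M_in_QSym by (intro qmult_qtensor) (auto simp: qsym_linear_def)
  have "qtensor_map F G (qtensor f g) = (\<Sum>p\<in>Poly_Mapping.keys c. pscale (Poly_Mapping.lookup c p)
    (\<Sum>q\<in>Poly_Mapping.keys d. pscale (Poly_Mapping.lookup d q) (qtensor (F (M p)) (G (M q)))))"
    unfolding c(2) d(2) qtensor_def[of "M_comb c"] M_coords_M_comb[OF c(1)] M_coords_M_comb[OF d(1)] qtensor_map_def
      lin_ext_def[of _ _ c] lin_ext_def[of _ _ d]
    by (simp add: plin_simps[OF plin_lin_ext] lin_ext_single[OF vector_space_pscale])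
  then have "qmult (qtensor_map F G (qtensor f g)) = (\<Sum>p\<in>Poly_Mapping.keys c. mscale (Poly_Mapping.lookup c p)
    (\<Sum>q\<in>Poly_Mapping.keys d. mscale (Poly_Mapping.lookup d q) (F (M p) * G (M q))))"
    by (simp add: Q.sum Q.scale basis)
  also have "\<dots> = F f * G g"
    unfolding c(2) d(2) qsym_linear_M_comb[OF F c(1)] qsym_linear_M_comb[OF G d(1)]
    by (simp add: sum_product mscale_mult_left mscale_mult_right mps.scale_sum_right mult.commute)
  finally show ?thesis .
qed

text \<open>Both \<open>X = F \<circ> S\<close> and \<open>X = S \<circ> F\<close> satisfy \<open>\<Sum>\<^sub>i X (M (take i p)) * F (M (drop i p)) = \<epsilon> (M p)\<close>: apply \<open>F\<close> to
  the antipode equation of \<open>M p\<close>, or use the antipode equation of \<open>F (M p)\<close>. The term with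
  \<open>i = length p\<close> is \<open>X (M p)\<close>, so the equation determines \<open>X (M p)\<close> from shorter compositions.\<close>
lemma antipode_commutes:
  fixes F S :: "'k::field mps \<Rightarrow> 'k mps"
  assumes F: "qsym_linear F" and one: "F 1 = 1"
    and mult: "\<And>f g. f \<in> QSym \<Longrightarrow> g \<in> QSym \<Longrightarrow> F (f * g) = F f * F g"
    and coprod: "\<And>f. f \<in> QSym \<Longrightarrow> qcoprod (F f) = qtensor_map F F (qcoprod f)"
    and counit: "\<And>f. f \<in> QSym \<Longrightarrow> qcounit (F f) = qcounit f"
    and S: "qsym_antipode S" and f: "f \<in> QSym"
  shows "F (S f) = S (F f)"
proof -
  interpret Q: Vector_Spaces.linear pscale mscale "qmult :: _ \<Rightarrow> 'k mps" by (rule linear_qmult)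
  have S_lin: "qsym_linear S" and id_lin: "qsym_linear (id :: 'k mps \<Rightarrow> _)"
    using S by (auto simp: qsym_antipode_def qsym_linear_def)
  have QS: "F f \<in> QSym" "S f \<in> QSym" if "f \<in> QSym" for f
    using F S_lin that by (auto simp: qsym_linear_def)
  have M_pieces: "M (take i p) \<in> (QSym :: 'k mps set)" "M (drop i p) \<in> (QSym :: 'k mps set)" if "p \<in> compositions" for p i
    using that by (simp_all add: M_in_QSym compositions_take_drop)
  have basis: "qtensor_map X Y (qcoprod (M p)) = (\<Sum>i\<le>length p. qtensor (X (M (take i p))) (Y (M (drop i p) :: 'k mps)))"
    if "p \<in> compositions" for X Y p
    using qtensor_map_qcoprod[of "word p" X Y] that
    by (simp add: M_comb_def lin_ext_single[OF vector_space_mscale] lin_ext_word)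
  have Sstar: "qmult (qtensor_map S id (qcoprod f)) = mscale (qcounit f) 1" if "f \<in> QSym" for f
    using S that by (simp add: qsym_antipode_def)
  have FS: "(\<Sum>i\<le>length p. F (S (M (take i p))) * F (M (drop i p))) = mscale (qcounit (M p)) 1"
    if p: "p \<in> compositions" for p
  proof -
    have F_sum: "F (\<Sum>i\<le>n. S (M (take i p)) * M (drop i p)) = (\<Sum>i\<le>n. F (S (M (take i p)) * M (drop i p)))" for n :: nat
    proof -
      have QSp: "S (M (take i p)) * M (drop i p) \<in> QSym" for i
        by (intro QSym_mult QS M_pieces p)
      show ?thesis
      proof (induction n)
        case (Suc n)
        have "(\<Sum>i\<le>n. S (M (take i p)) * M (drop i p)) \<in> QSym"
          by (intro mps.subspace_sum subspace_QSym QSp)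
        then show ?case using Suc F QSp by (simp add: qsym_linear_def)
      qed simp
    qed
    have "(\<Sum>i\<le>length p. S (M (take i p)) * M (drop i p)) = mscale (qcounit (M p)) 1"
      using Sstar[OF M_in_QSym[OF p]]
      by (simp add: basis[OF p] Q.sum qmult_qtensor QS M_pieces[OF p])
    then have "F (\<Sum>i\<le>length p. S (M (take i p)) * M (drop i p)) = mscale (qcounit (M p)) 1"
      using F one by (simp add: qsym_linear_def one_in_QSym)
    then show ?thesis by (simp add: F_sum mult QS M_pieces[OF p])
  qed
  have SF: "(\<Sum>i\<le>length p. S (F (M (take i p))) * F (M (drop i p))) = mscale (qcounit (M p)) 1"
    if p: "p \<in> compositions" for p
  proof -
    have "mscale (qcounit (M p)) 1 = qmult (qtensor_map S id (qcoprod (F (M p))))"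
      using Sstar[OF QS(1)[OF M_in_QSym[OF p]]] counit[OF M_in_QSym[OF p]] by simp
    also have "\<dots> = (\<Sum>i\<le>length p. qmult (qtensor_map S id (qtensor (F (M (take i p))) (F (M (drop i p))))))"
      by (simp only: coprod[OF M_in_QSym[OF p]] basis[OF p] plin_simps(5)[OF plin_qtensor_map] Q.sum)
    also have "\<dots> = (\<Sum>i\<le>length p. S (F (M (take i p))) * F (M (drop i p)))"
      by (simp add: qmult_qtensor_map_qtensor[OF S_lin id_lin] QS M_pieces[OF p])
    finally show ?thesis by simp
  qed
  have FS_M: "F (S (M p)) = S (F (M p))" if "p \<in> compositions" for p
    using that
  proof (induction p rule: length_induct)
    case (1 p)
    have p: "p \<in> compositions" by (rule "1.prems")
    have "F (S (M (take i p))) = S (F (M (take i p)))" if "i < length p" for i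
      using 1 that by (simp add: compositions_take_drop)
    then have "(\<Sum>i<length p. F (S (M (take i p))) * F (M (drop i p))) = (\<Sum>i<length p. S (F (M (take i p))) * F (M (drop i p)))"
      by simp
    moreover have "(\<Sum>i\<le>length p. F (S (M (take i p))) * F (M (drop i p))) = (\<Sum>i\<le>length p. S (F (M (take i p))) * F (M (drop i p)))"
      by (simp only: FS[OF p] SF[OF p])
    ultimately show ?case
      by (simp add: lessThan_Suc_atMost[symmetric] M_Nil one)
  qed
  have FS_lin: "qsym_linear (\<lambda>f. F (S f))" and SF_lin: "qsym_linear (\<lambda>f. S (F f))"
    using F S_lin by (auto simp: qsym_linear_def)
  obtain c where c: "Poly_Mapping.keys c \<subseteq> compositions" "f = M_comb c" using QSym_cases[OF f] .
  show ?thesis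
    unfolding c(2) qsym_linear_M_comb[OF FS_lin c(1)] qsym_linear_M_comb[OF SF_lin c(1)]
    using c(1) by (intro sum.cong) (auto simp: FS_M)
qed

theorem theorem11p1:
  shows "qsym_hopf_endomorphism (U_QSym :: 'k::field mps \<Rightarrow> 'k mps)"
proof -
  let ?U = "U_QSym :: 'k mps \<Rightarrow> _"
  note U = U_QSym_eq_doubling
  have lin: "qsym_linear ?U"
    unfolding qsym_linear_def
    by (auto simp: U doubling_in_QSym doubling_add doubling_mscale
        mps.subspace_add[OF subspace_QSym] mps.subspace_scale[OF subspace_QSym])
  have one: "?U 1 = 1" by (simp add: U one_in_QSym doubling_one)
  have mult: "?U (f * g) = ?U f * ?U g" if "f \<in> QSym" "g \<in> QSym" for f g
    using that by (simp add: U QSym_mult doubling_mult)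
  have counit: "qcounit (?U f) = qcounit f" if "f \<in> QSym" for f
    using that by (simp add: U qcounit_def coeff_doubling_0)
  have coprod: "qcoprod (?U f) = qtensor_map ?U ?U (qcoprod f)" if f: "f \<in> QSym" for f
  proof -
    obtain c where c: "Poly_Mapping.keys c \<subseteq> compositions" "f = M_comb c" using QSym_cases[OF f] .
    have "M (take i p) \<in> (QSym :: 'k mps set)" "M (drop i p) \<in> (QSym :: 'k mps set)"
      if "p \<in> compositions" for p i
      using that by (simp_all add: M_in_QSym compositions_take_drop)
    then have "qtensor_map ?U ?U (qcoprod f) = qtensor_map doubling doubling (qcoprod f)"
      unfolding c(2) qtensor_map_qcoprod[OF c(1)] lin_ext_def
      using c(1) by (intro sum.cong) (auto simp: U intro!: arg_cong[of _ _ "pscale _"] sum.cong)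
    then show ?thesis by (simp add: U f doubling_qcoprod)
  qed
  show ?thesis
    unfolding qsym_hopf_endomorphism_def
    using lin one mult coprod counit antipode_commutes[OF lin one mult coprod counit] by blast
qed

end
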